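(* Let $I\subseteq\mathbb{R}$ be an open interval and let $a,b,c,d:I\to\mathbb{R}$ be smooth functions of $t$ with $d(t)\neq0$ for every $t\in I$. Consider the fifth-order evolution equation $F=0$, where $$F=u_t+d(t)u_{xxxxx}+a(t)uu_{xxx}+b(t)u_xu_{xx}+c(t)u^2u_x .$$ In each of the following cases the equation is nonlinearly self-adjoint, and the functions $\phi=\phi(x,t,u)$ for which $F^{\ast}|_{v=\phi}=\lambda F$ holds for some differential function $\lambda$ are exactly those of the indicated form, where $c_1,c_2,c_3$ are arbitrary real constants (with $\phi\not\equiv0$). All conditions on $a,b,c$ are required at every $t\in I$. (Type 5-I) $b\neq2a$ and $b\neq3a$, with $a$ and $c$ otherwise unrestricted: $\phi=c_1$. (Type 5-II) $b=3a$, $a\neq0$, $c\neq0$: $\phi=c_1$. (Type 5-III) $b=3a$, $a\neq0$, $c=0$: $\phi=c_1x^2+c_2x+c_3$. (Type 5-IV) $b=2a$, $a\neq0$, $c$ unrestricted: $\phi=c_1u+c_2$. (Type 5-V) $a=b=0$, $c\neq0$: $\phi=c_1u+c_2$.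
   Context: A differential function is a smooth (locally analytic) function of finitely many of the variables $x,t,u$ and the derivatives of $u$; here $x,t,u$ and the derivatives $u_t,u_x,u_{xx},u_{xt},\dots$ are treated as independent variables, and $D_x,D_t$ denote total derivatives. For an evolution equation $F=0$, the formal Lagrangian is $\mathcal{L}=vF$ with $v=v(x,t)$ a new dependent variable, and the adjoint equation is $F^{\ast}=0$ with $F^{\ast}=\frac{\delta\mathcal{L}}{\delta u}$, where $$\frac{\delta}{\delta u}=\frac{\partial}{\partial u}+\sum_{j\ge1}(-1)^jD_{i_1}\cdots D_{i_j}\frac{\partial}{\partial u_{i_1\cdots i_j}}$$ is the Euler-Lagrange operator. For the $F$ in the claim one has $$F^{\ast}=-v_t+[(b-3a)u_{xx}-cu^2]v_x+(b-3a)u_xv_{xx}-auv_{xxx}-dv_{xxxxx}.$$ The equation $F=0$ is called nonlinearly self-adjoint if there is a function $\phi=\phi(x,t,u)$, not identically zero, such that $F^{\ast}|_{v=\phi}=\lambda F$ for some differential function $\lambda$; here $F^{\ast}|_{v=\phi}$ is obtained from $F^{\ast}$ by replacing $v$ by $\phi(x,t,u)$ and the derivatives of $v$ by the corresponding total derivatives of $\phi$, and the identity is understood identically in $x,t,u$ and all derivatives of $u$. Functions $\phi$ are taken smooth on $\mathbb{R}\times I\times\mathbb{R}$. *)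

theory Defs
  imports "HOL-Analysis.Analysis" "HOL-Library.Groups_Big_Fun"
begin

text \<open>
  Jet coordinates: the independent variables \<open>x\<close>, \<open>t\<close> and, for the two dependent variables
  \<open>u\<close> and \<open>v\<close>, the derivatives of order \<open>m\<close> in \<open>x\<close> and \<open>n\<close> in \<open>t\<close>, written \<open>U m n\<close> and \<open>V m n\<close>.
  So \<open>U 0 0\<close> is \<open>u\<close> itself and \<open>U 1 1\<close> is \<open>u_xt\<close>.
\<close>

datatype jcoord = X | T | U nat nat | V nat nat

type_synonym jet = "jcoord \<Rightarrow> real"

type_synonym jfun = "jet \<Rightarrow> real"

definition jets :: "real set \<Rightarrow> jet set" where
  "jets I = {p. p T \<in> I}"

definition pd :: "jcoord \<Rightarrow> jfun \<Rightarrow> jfun" where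
  "pd z f = (\<lambda>p. deriv (\<lambda>s. f (p(z := s))) (p z))"

text \<open>
  All iterated partial derivatives exist and are continuous on \<open>D\<close>. Continuity is for the product
  topology; for a function of finitely many coordinates this is continuity in those coordinates.
\<close>

definition smooth_jfun :: "jet set \<Rightarrow> jfun \<Rightarrow> bool" where
  "smooth_jfun D f \<longleftrightarrow>
    (\<forall>zs. continuous_on D (foldr pd zs f) \<and>
          (\<forall>z. \<forall>p\<in>D. (\<lambda>s. foldr pd zs f (p(z := s))) differentiable (at (p z))))"

text \<open>Differential functions of \<open>x\<close>, \<open>t\<close>, \<open>u\<close>: the coordinates of \<open>v\<close> are not allowed.\<close>

definition differential_function :: "real set \<Rightarrow> jfun \<Rightarrow> bool" where
  "differential_function I f \<longleftrightarrow>
    smooth_jfun (jets I) f \<and>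
    (\<exists>S. finite S \<and> S \<inter> range (case_prod V) = {} \<and>
         (\<forall>p\<in>jets I. \<forall>q\<in>jets I. (\<forall>z\<in>S. p z = q z) \<longrightarrow> f p = f q))"

text \<open>
  For functions of finitely many coordinates the sums over all \<open>(m, n)\<close> below have finite support;
  \<^const>\<open>Sum_any\<close> sums over the support.
\<close>

definition Dx :: "jfun \<Rightarrow> jfun" where
  "Dx f = (\<lambda>p. pd X f p
     + Sum_any (\<lambda>(m, n). p (U (Suc m) n) * pd (U m n) f p)
     + Sum_any (\<lambda>(m, n). p (V (Suc m) n) * pd (V m n) f p))"

definition Dt :: "jfun \<Rightarrow> jfun" where
  "Dt f = (\<lambda>p. pd T f p
     + Sum_any (\<lambda>(m, n). p (U m (Suc n)) * pd (U m n) f p)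
     + Sum_any (\<lambda>(m, n). p (V m (Suc n)) * pd (V m n) f p))"

text \<open>The Euler-Lagrange operator; each derivative of \<open>u\<close> contributes one term.\<close>

definition euler_u :: "jfun \<Rightarrow> jfun" where
  "euler_u L = (\<lambda>p. Sum_any (\<lambda>(m, n).
     (- 1) ^ (m + n) * (Dx ^^ m) ((Dt ^^ n) (pd (U m n) L)) p))"

definition formal_lagrangian :: "jfun \<Rightarrow> jfun" where
  "formal_lagrangian F = (\<lambda>p. p (V 0 0) * F p)"

definition adjoint_eq :: "jfun \<Rightarrow> jfun" where
  "adjoint_eq F = euler_u (formal_lagrangian F)"

definition lift :: "(real \<Rightarrow> real \<Rightarrow> real \<Rightarrow> real) \<Rightarrow> jfun" where
  "lift \<phi> = (\<lambda>p. \<phi> (p X) (p T) (p (U 0 0)))"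

definition subst_v :: "(real \<Rightarrow> real \<Rightarrow> real \<Rightarrow> real) \<Rightarrow> jfun \<Rightarrow> jfun" where
  "subst_v \<phi> G = (\<lambda>p. G (\<lambda>z. case z of V m n \<Rightarrow> (Dx ^^ m) ((Dt ^^ n) (lift \<phi>)) p | _ \<Rightarrow> p z))"

text \<open>
  Smoothness of \<open>\<phi>\<close> on \<open>\<real> \<times> I \<times> \<real>\<close>: the only partial derivatives of \<^term>\<open>lift \<phi>\<close> that do not
  vanish identically are those in \<open>X\<close>, \<open>T\<close>, \<open>U 0 0\<close>, which are the partial derivatives of \<open>\<phi>\<close>.
\<close>

definition smooth_xtu :: "real set \<Rightarrow> (real \<Rightarrow> real \<Rightarrow> real \<Rightarrow> real) \<Rightarrow> bool" where
  "smooth_xtu I \<phi> \<longleftrightarrow> smooth_jfun (jets I) (lift \<phi>)"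

definition nonzero_xtu :: "real set \<Rightarrow> (real \<Rightarrow> real \<Rightarrow> real \<Rightarrow> real) \<Rightarrow> bool" where
  "nonzero_xtu I \<phi> \<longleftrightarrow> (\<exists>x. \<exists>t\<in>I. \<exists>u. \<phi> x t u \<noteq> 0)"

definition adjoint_identity ::
    "real set \<Rightarrow> jfun \<Rightarrow> (real \<Rightarrow> real \<Rightarrow> real \<Rightarrow> real) \<Rightarrow> bool" where
  "adjoint_identity I F \<phi> \<longleftrightarrow>
    (\<exists>lam. differential_function I lam \<and>
           (\<forall>p\<in>jets I. subst_v \<phi> (adjoint_eq F) p = lam p * F p))"

definition nonlinearly_self_adjoint :: "real set \<Rightarrow> jfun \<Rightarrow> bool" where
  "nonlinearly_self_adjoint I F \<longleftrightarrow>
    (\<exists>\<phi>. smooth_xtu I \<phi> \<and> nonzero_xtu I \<phi> \<and> adjoint_identity I F \<phi>)"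

text \<open>
  The equation is nonlinearly self-adjoint, and its nonzero substitutions are exactly the nonzero
  functions that coincide on \<open>\<real> \<times> I \<times> \<real>\<close> with a member of the family \<open>\<Phi>\<close>. Values of
  \<open>\<phi>\<close> at \<open>t \<notin> I\<close> are immaterial.
\<close>

definition self_adjoint_exactly ::
    "real set \<Rightarrow> jfun \<Rightarrow> (real \<Rightarrow> real \<Rightarrow> real \<Rightarrow> real) set \<Rightarrow> bool" where
  "self_adjoint_exactly I F \<Phi> \<longleftrightarrow>
    nonlinearly_self_adjoint I F \<and>
    (\<forall>\<phi>. smooth_xtu I \<phi> \<and> nonzero_xtu I \<phi> \<and> adjoint_identity I F \<phi> \<longleftrightarrow>
          nonzero_xtu I \<phi> \<and> (\<exists>\<psi>\<in>\<Phi>. \<forall>x. \<forall>t\<in>I. \<forall>u. \<phi> x t u = \<psi> x t u))"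

definition smooth_coeff :: "real set \<Rightarrow> (real \<Rightarrow> real) \<Rightarrow> bool" where
  "smooth_coeff I f \<longleftrightarrow> (\<forall>n. (deriv ^^ n) f differentiable_on I)"

definition evolution5 ::
    "(real \<Rightarrow> real) \<Rightarrow> (real \<Rightarrow> real) \<Rightarrow> (real \<Rightarrow> real) \<Rightarrow> (real \<Rightarrow> real) \<Rightarrow> jfun" where
  "evolution5 a b c d = (\<lambda>p.
     p (U 0 1) + d (p T) * p (U 5 0) + a (p T) * p (U 0 0) * p (U 3 0)
     + b (p T) * p (U 1 0) * p (U 2 0) + c (p T) * (p (U 0 0))\<^sup>2 * p (U 1 0))"

end

(*
  On the jets solving F = 0 for u_t, the identity F^* = lambda F says that F^* vanishes. There
  F^* depends on u_xxxx only through D_x^5 phi, in which u_xxxx is multiplied by 5 D_x(phi_u)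
  (up to the order of mixed derivatives). Hence phi = A(t) u + B(x, t), and for such phi

    F^* + A F = - phi_t + 3 A (b - 2a) u_x u_xx + ((b - 3a) u_xx - c u^2) B_x
                + (b - 3a) u_x B_xx - a u B_xxx - d B_xxxxx.

  The coefficients of u_x and u_xx give A (b - 2a) = 0 and (b - 3a) B_x = 0, and c B_x = 0
  because phi_t is affine in u. Then phi_t = 0: either B_x = 0, or b = 3a and c = 0 with A = 0,
  where phi does not involve u and therefore a B_xxx = 0. Conversely these conditions make the
  right-hand side vanish, with the constant multiplier lambda = - A.
*)

theory Submission
  imports Defs
begin

section \<open>Differentiation rules for the total derivative in \<open>x\<close>\<close>

text \<open>The choice of u_xxxx: u_xxxxx and u_t enter F^* with coefficients -d phi_u and -phi_u,
  so eliminating u_t through F = 0 removes both and u_xxxxx gives no information. F does not contain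
  u_xxxx, hence the elimination leaves it alone and its coefficient in D_x^5 phi must vanish as it
  stands. That coefficient is affine in the free variable u_x, which gives two equations. The
  obstacle: phi is smooth over \<open>I\<close> only and arbitrary elsewhere, whereas rewriting
  under iterated \<open>Dx\<close> takes equations between functions on all jets. The work in the
  x-direction is therefore done for the extension of phi by zero, which may be discontinuous in t.
  Hence differentiability is asked in every coordinate except \<open>T\<close>, and the t-derivative
  of phi is handled separately.\<close>

text \<open>The coordinate \<open>T\<close> is exempt: \<^const>\<open>Dx\<close> never differentiates in it, so the coefficients \<open>a, b, c, d\<close>
  count as constants.\<close>

definition xdiff :: "jfun \<Rightarrow> bool" where
  "xdiff f \<longleftrightarrow> (\<forall>z p. z \<noteq> T \<longrightarrow> (\<lambda>s. f (p(z := s))) differentiable (at (p z)))"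

definition dep :: "jcoord set \<Rightarrow> jfun \<Rightarrow> bool" where
  "dep S f \<longleftrightarrow> (\<forall>p q. (\<forall>z\<in>S. p z = q z) \<longrightarrow> f p = f q)"

definition adm :: "jfun \<Rightarrow> bool" where
  "adm f \<longleftrightarrow> xdiff f \<and> (\<exists>S. finite S \<and> dep S f)"

lemma depD: "dep S f \<Longrightarrow> (\<And>z. z \<in> S \<Longrightarrow> p z = q z) \<Longrightarrow> f p = f q"
  by (auto simp: dep_def)

lemma dep_mono: "dep S f \<Longrightarrow> S \<subseteq> S' \<Longrightarrow> dep S' f"
  unfolding dep_def by blast

lemma dep_fun_upd: "dep S f \<Longrightarrow> z \<notin> S \<Longrightarrow> f (p(z := s)) = f p"
  by (erule depD) auto

lemma pd_notin: "dep S f \<Longrightarrow> z \<notin> S \<Longrightarrow> pd z f p = 0"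
  unfolding pd_def by (simp add: dep_fun_upd)

lemma dep_pd:
  assumes "dep S f" shows "dep S (pd z f)"
proof (cases "z \<in> S")
  case True
  show ?thesis unfolding dep_def
  proof (intro allI impI)
    fix p q :: jet assume pq: "\<forall>z\<in>S. p z = q z"
    have "(\<lambda>s. f (p(z := s))) = (\<lambda>s. f (q(z := s)))"
      using pq by (intro ext depD[OF assms]) auto
    then show "pd z f p = pd z f q" using pq True by (simp add: pd_def)
  qed
qed (simp add: dep_def pd_notin[OF assms])

lemma dep_add: "dep S f \<Longrightarrow> dep S g \<Longrightarrow> dep S (\<lambda>p. f p + g p)"
  unfolding dep_def by metis

lemma dep_mult: "dep S f \<Longrightarrow> dep S g \<Longrightarrow> dep S (\<lambda>p. f p * g p)"
  unfolding dep_def by metis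

lemma xdiffD:
  assumes "xdiff f" "z \<noteq> T"
  shows "((\<lambda>s. f (p(z := s))) has_real_derivative pd z f p) (at (p z))"
proof -
  obtain D where "((\<lambda>s. f (p(z := s))) has_real_derivative D) (at (p z))"
    using assms unfolding xdiff_def real_differentiable_def by blast
  then show ?thesis by (simp add: pd_def DERIV_imp_deriv)
qed

lemma pd_eqI: "((\<lambda>s. f (p(z := s))) has_real_derivative D) (at (p z)) \<Longrightarrow> pd z f p = D"
  by (simp add: pd_def DERIV_imp_deriv)

lemma xdiffI:
  assumes "\<And>z p. z \<noteq> T \<Longrightarrow> ((\<lambda>s. f (p(z := s))) has_real_derivative D z p) (at (p z))"
  shows "xdiff f"
  using assms unfolding xdiff_def real_differentiable_def by blast

lemma pd_add:
  "xdiff f \<Longrightarrow> xdiff g \<Longrightarrow> z \<noteq> T \<Longrightarrow> pd z (\<lambda>p. f p + g p) = (\<lambda>p. pd z f p + pd z g p)"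
  by (intro ext pd_eqI DERIV_add xdiffD)

lemma DERIV_coord_mult:
  assumes "xdiff f" "xdiff g" "z \<noteq> T"
  shows "((\<lambda>s. f (p(z := s)) * g (p(z := s))) has_real_derivative
           pd z f p * g p + f p * pd z g p) (at (p z))"
  using DERIV_mult[OF xdiffD[OF assms(1,3), of p] xdiffD[OF assms(2,3), of p]]
  by (simp add: algebra_simps)

lemma pd_mult:
  "xdiff f \<Longrightarrow> xdiff g \<Longrightarrow> z \<noteq> T \<Longrightarrow>
     pd z (\<lambda>p. f p * g p) = (\<lambda>p. pd z f p * g p + f p * pd z g p)"
  by (intro ext pd_eqI DERIV_coord_mult)

lemma xdiff_add: "xdiff f \<Longrightarrow> xdiff g \<Longrightarrow> xdiff (\<lambda>p. f p + g p)"
  by (rule xdiffI, rule DERIV_add[OF xdiffD xdiffD])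

lemma xdiff_mult: "xdiff f \<Longrightarrow> xdiff g \<Longrightarrow> xdiff (\<lambda>p. f p * g p)"
  by (rule xdiffI, rule DERIV_coord_mult)

lemma DERIV_coord: "((\<lambda>s. (p(z := s)) w) has_real_derivative (if w = z then 1 else 0)) (at (p z))"
  by auto

lemma pd_coord: "pd z (\<lambda>p. p w) = (\<lambda>p. if w = z then 1 else 0)"
  by (intro ext pd_eqI DERIV_coord)

lemma xdiff_coord: "xdiff (\<lambda>p. p w)"
  by (rule xdiffI, rule DERIV_coord)

lemma pd_coeff: "z \<noteq> T \<Longrightarrow> pd z (\<lambda>p. h (p T)) = (\<lambda>p. 0)"
  by (auto simp: pd_def)

lemma xdiff_coeff: "xdiff (\<lambda>p. h (p T))"
  by (auto simp: xdiff_def)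

lemma pd_const: "pd z (\<lambda>p. k) = (\<lambda>p. 0)"
  by (auto simp: pd_def)

section \<open>Total derivatives as finite sums\<close>

lemma Dx_eq_sum:
  assumes "dep S f" "finite K"
    and "\<And>m n. U m n \<in> S \<Longrightarrow> (m, n) \<in> K" "\<And>m n. V m n \<in> S \<Longrightarrow> (m, n) \<in> K"
  shows "Dx f = (\<lambda>p. pd X f p + (\<Sum>(m, n)\<in>K. p (U (Suc m) n) * pd (U m n) f p)
                 + (\<Sum>(m, n)\<in>K. p (V (Suc m) n) * pd (V m n) f p))"
proof
  fix p
  have "Sum_any (\<lambda>(m, n). p (U (Suc m) n) * pd (U m n) f p)
        = (\<Sum>(m, n)\<in>K. p (U (Suc m) n) * pd (U m n) f p)"
    using assms(2,3) pd_notin[OF assms(1), of "U _ _"] by (intro Sum_any.expand_superset) (auto, blast)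
  moreover have "Sum_any (\<lambda>(m, n). p (V (Suc m) n) * pd (V m n) f p)
        = (\<Sum>(m, n)\<in>K. p (V (Suc m) n) * pd (V m n) f p)"
    using assms(2,4) pd_notin[OF assms(1), of "V _ _"] by (intro Sum_any.expand_superset) (auto, blast)
  ultimately show "Dx f p = pd X f p + (\<Sum>(m, n)\<in>K. p (U (Suc m) n) * pd (U m n) f p)
                 + (\<Sum>(m, n)\<in>K. p (V (Suc m) n) * pd (V m n) f p)"
    unfolding Dx_def by simp
qed

text \<open>Additivity and the product rule for \<open>Dx\<close> hold term by term once
  \<open>f\<close>, \<open>g\<close> and their sum or product are all summed over one index
  set.\<close>

lemma common_support:
  assumes "adm f" "adm g"
  obtains S K where "finite S" "dep S f" "dep S g" "finite K"
    "\<And>m n. U m n \<in> S \<Longrightarrow> (m, n) \<in> K" "\<And>m n. V m n \<in> S \<Longrightarrow> (m, n) \<in> K"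
proof -
  obtain S1 S2 where S: "finite S1" "dep S1 f" "finite S2" "dep S2 g"
    using assms by (auto simp: adm_def)
  let ?S = "S1 \<union> S2"
  let ?K = "case_prod U -` ?S \<union> case_prod V -` ?S"
  have "finite ?K" using S by (intro finite_UnI finite_vimageI) (auto simp: inj_on_def)
  then show ?thesis using S by (intro that[of ?S ?K]) (auto intro: dep_mono)
qed

lemma adm_add: "adm f \<Longrightarrow> adm g \<Longrightarrow> adm (\<lambda>p. f p + g p)"
  by (metis common_support adm_def dep_add xdiff_add)

lemma adm_mult: "adm f \<Longrightarrow> adm g \<Longrightarrow> adm (\<lambda>p. f p * g p)"
  by (metis common_support adm_def dep_mult xdiff_mult)

lemma adm_coord: "adm (\<lambda>p. p w)"
  unfolding adm_def by (intro conjI xdiff_coord exI[of _ "{w}"]) (auto simp: dep_def)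

lemma adm_coeff: "adm (\<lambda>p. h (p T))"
  unfolding adm_def by (intro conjI xdiff_coeff exI[of _ "{T}"]) (auto simp: dep_def)

lemma Dx_add:
  assumes "adm f" "adm g"
  shows "Dx (\<lambda>p. f p + g p) = (\<lambda>p. Dx f p + Dx g p)"
proof -
  obtain S K where K: "finite S" "dep S f" "dep S g" "finite K"
    "\<And>m n. U m n \<in> S \<Longrightarrow> (m, n) \<in> K" "\<And>m n. V m n \<in> S \<Longrightarrow> (m, n) \<in> K"
    using common_support[OF assms] by metis
  note d = Dx_eq_sum[where S = S and K = K]
  have x: "xdiff f" "xdiff g" using assms by (auto simp: adm_def)
  show ?thesis
    by (subst (1 2 3) d)
      (use K x in \<open>auto simp: dep_add pd_add sum.distrib split_def algebra_simps\<close>)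
qed

lemma Dx_mult:
  assumes "adm f" "adm g"
  shows "Dx (\<lambda>p. f p * g p) = (\<lambda>p. Dx f p * g p + f p * Dx g p)"
proof -
  obtain S K where K: "finite S" "dep S f" "dep S g" "finite K"
    "\<And>m n. U m n \<in> S \<Longrightarrow> (m, n) \<in> K" "\<And>m n. V m n \<in> S \<Longrightarrow> (m, n) \<in> K"
    using common_support[OF assms] by metis
  note d = Dx_eq_sum[where S = S and K = K]
  have x: "xdiff f" "xdiff g" using assms by (auto simp: adm_def)
  show ?thesis
    by (subst (1 2 3) d)
      (use K x in \<open>auto simp: dep_mult pd_mult sum.distrib sum_distrib_left split_def algebra_simps\<close>)
qed

lemma Dx_coeff: "Dx (\<lambda>p. h (p T)) = (\<lambda>p. 0)"
  by (auto simp: Dx_def pd_coeff)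

lemma Dx_const: "Dx (\<lambda>p. k) = (\<lambda>p. 0)"
  by (auto simp: Dx_def pd_const)

lemma Dx_U: "Dx (\<lambda>p. p (U m n)) = (\<lambda>p. p (U (Suc m) n))"
  by (subst Dx_eq_sum[of "{U m n}" _ "{(m, n)}"]) (auto simp: dep_def pd_coord)

lemma Dx_V: "Dx (\<lambda>p. p (V m n)) = (\<lambda>p. p (V (Suc m) n))"
  by (subst Dx_eq_sum[of "{V m n}" _ "{(m, n)}"]) (auto simp: dep_def pd_coord)

text \<open>The one rule for \<open>Dt\<close> that the adjoint calls for: u_t has coefficient 1 in
  F, so the Lagrangian has u_t-derivative v and no coefficient is ever differentiated in t.\<close>

lemma Dt_V: "Dt (\<lambda>p. p (V m n)) = (\<lambda>p. p (V m (Suc n)))"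
proof
  fix p
  have "Sum_any (\<lambda>(i, j). p (V i (Suc j)) * pd (V i j) (\<lambda>p. p (V m n)) p)
        = (\<Sum>(i, j)\<in>{(m, n)}. p (V i (Suc j)) * pd (V i j) (\<lambda>p. p (V m n)) p)"
    by (intro Sum_any.expand_superset) (auto simp: pd_coord split: if_splits)
  then show "Dt (\<lambda>p. p (V m n)) p = p (V m (Suc n))"
    by (simp add: Dt_def pd_coord)
qed

lemma Dx_funpow_zero: "(Dx ^^ m) (\<lambda>p. 0) = (\<lambda>p. 0)"
  by (induction m) (auto simp: Dx_const)

lemma Dt_funpow_zero: "(Dt ^^ m) (\<lambda>p. 0) = (\<lambda>p. 0)"
  by (induction m) (auto simp: Dt_def pd_const)



section \<open>The adjoint equation\<close>

text \<open>All terms with undifferentiated v cancel: a u_xxx between \<open>G00\<close> and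
  \<open>D3\<close>, 2 c u u_x between \<open>G00\<close> and \<open>D1\<close>, b u_xxx between
  \<open>D1\<close> and \<open>D2\<close>. Hence every constant v solves the adjoint
  equation.\<close>

lemma adjoint_evolution5:
  "adjoint_eq (evolution5 a b c d) p =
     - p (V 0 1) + ((b (p T) - 3 * a (p T)) * p (U 2 0) - c (p T) * (p (U 0 0))\<^sup>2) * p (V 1 0)
     + (b (p T) - 3 * a (p T)) * p (U 1 0) * p (V 2 0) - a (p T) * p (U 0 0) * p (V 3 0)
     - d (p T) * p (V 5 0)"
proof -
  define L where "L = formal_lagrangian (evolution5 a b c d)"
  define G :: "nat \<Rightarrow> nat \<Rightarrow> jfun" where "G m n = pd (U m n) L" for m n
  define S :: "(nat \<times> nat) set" where "S = {(0,0),(1,0),(2,0),(3,0),(5,0),(0,1)}"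
  note defs = G_def L_def formal_lagrangian_def evolution5_def
  have G00: "G 0 0 = (\<lambda>p. p (V 0 0) * (a (p T) * p (U 3 0) + 2 * c (p T) * p (U 0 0) * p (U 1 0)))"
    unfolding defs
    by (intro ext pd_eqI) (auto intro!: derivative_eq_intros simp: power2_eq_square algebra_simps)
  have G10: "G 1 0 = (\<lambda>p. p (V 0 0) * (b (p T) * p (U 2 0) + c (p T) * (p (U 0 0) * p (U 0 0))))"
    unfolding defs
    by (intro ext pd_eqI) (auto intro!: derivative_eq_intros simp: power2_eq_square algebra_simps)
  have G20: "G 2 0 = (\<lambda>p. p (V 0 0) * (b (p T) * p (U 1 0)))"
    unfolding defs by (intro ext pd_eqI) (auto intro!: derivative_eq_intros)
  have G30: "G 3 0 = (\<lambda>p. p (V 0 0) * (a (p T) * p (U 0 0)))"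
    unfolding defs by (intro ext pd_eqI) (auto intro!: derivative_eq_intros)
  have G50: "G 5 0 = (\<lambda>p. d (p T) * p (V 0 0))"
    unfolding defs by (intro ext pd_eqI) (auto intro!: derivative_eq_intros)
  have G01: "G 0 1 = (\<lambda>p. p (V 0 0))"
    unfolding defs by (intro ext pd_eqI) (auto intro!: derivative_eq_intros)
  have "dep (insert T (insert (V 0 0) (case_prod U ` S))) L"
    unfolding dep_def L_def formal_lagrangian_def evolution5_def S_def by simp
  then have G_else: "G m n = (\<lambda>p. 0)" if "(m, n) \<notin> S" for m n
    unfolding G_def using that by (intro ext pd_notin) auto
  have s: "adjoint_eq (evolution5 a b c d) p =
      (\<Sum>(m, n)\<in>S. (- 1) ^ (m + n) * (Dx ^^ m) ((Dt ^^ n) (G m n)) p)"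
    unfolding adjoint_eq_def euler_u_def L_def[symmetric] G_def[symmetric]
  proof (rule Sum_any.expand_superset)
    show "{x. (case x of (m, n) \<Rightarrow> (- 1) ^ (m + n) * (Dx ^^ m) ((Dt ^^ n) (G m n)) p) \<noteq> 0} \<subseteq> S"
    proof (clarify, rule ccontr)
      fix m n
      assume *: "(- 1) ^ (m + n) * (Dx ^^ m) ((Dt ^^ n) (G m n)) p \<noteq> 0" and "(m, n) \<notin> S"
      from this(2) have "G m n = (\<lambda>p. 0)" by (rule G_else)
      with * show False by (simp add: Dt_funpow_zero Dx_funpow_zero)
    qed
  qed (simp add: S_def)
  have *: "Dx (\<lambda>p. h (p T) * f p) = (\<lambda>p. h (p T) * Dx f p)" "adm (\<lambda>p. h (p T) * f p)"
    if "adm f" for h f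
    using that by (simp_all add: Dx_mult adm_mult adm_coeff Dx_coeff)
  \<comment> \<open>\<open>h (p T)\<close> is not a higher-order pattern, so the rules are
    instantiated with each coefficient before rewriting.\<close>
  note * = *[where h = "\<lambda>_. 2"] *[where h = a] *[where h = b] *[where h = c] *[where h = d]
  have D1: "Dx (G 1 0) = (\<lambda>p. p (V 1 0) * (b (p T) * p (U 2 0) + c (p T) * (p (U 0 0) * p (U 0 0)))
     + p (V 0 0) * (b (p T) * p (U 3 0) + c (p T) * (p (U 1 0) * p (U 0 0) + p (U 0 0) * p (U 1 0))))"
    unfolding G10 by (simp add: Dx_mult Dx_add * adm_mult adm_add adm_coord Dx_U Dx_V numeral_eq_Suc)
  have D2: "Dx (Dx (G 2 0)) = (\<lambda>p. p (V 2 0) * (b (p T) * p (U 1 0))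
     + p (V 1 0) * (b (p T) * p (U 2 0)) + (p (V 1 0) * (b (p T) * p (U 2 0)) + p (V 0 0) * (b (p T) * p (U 3 0))))"
    unfolding G20 by (simp add: Dx_mult Dx_add * adm_mult adm_add adm_coord Dx_U Dx_V numeral_eq_Suc)
  have D3: "Dx (Dx (Dx (G 3 0))) = (\<lambda>p. p (V 3 0) * (a (p T) * p (U 0 0))
     + 3 * p (V 2 0) * (a (p T) * p (U 1 0)) + 3 * p (V 1 0) * (a (p T) * p (U 2 0)) + p (V 0 0) * (a (p T) * p (U 3 0)))"
    unfolding G30 
    by (rule ext, simp add: Dx_mult Dx_add * adm_mult adm_add adm_coord Dx_U Dx_V numeral_eq_Suc)
       (simp add: eval_nat_numeral algebra_simps)
  have D5: "Dx (Dx (Dx (Dx (Dx (G 5 0))))) = (\<lambda>p. d (p T) * p (V 5 0))"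
    unfolding G50 by (simp add: * adm_mult adm_coord Dx_V numeral_eq_Suc)
  have D01: "Dt (G 0 1) = (\<lambda>p. p (V 0 1))"
    unfolding G01 by (simp add: Dt_V)
  have "adjoint_eq (evolution5 a b c d) p = G 0 0 p - Dx (G 1 0) p + Dx (Dx (G 2 0)) p
      - Dx (Dx (Dx (G 3 0))) p - Dx (Dx (Dx (Dx (Dx (G 5 0))))) p - Dt (G 0 1) p"
    unfolding s S_def by (simp add: numeral_eq_Suc)
  then show ?thesis
    unfolding D1 D2 D3 D5 D01 G00 by (simp add: power2_eq_square algebra_simps)
qed

section \<open>The highest derivatives in iterated total derivatives\<close>

text \<open>Since \<^const>\<open>Dx\<close> does not move \<open>t\<close>, it commutes with this extension, and identities on
  \<^term>\<open>jets I\<close> become identities of functions that can be rewritten under further \<^const>\<open>Dx\<close>.\<close>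

definition zero_ext :: "real set \<Rightarrow> jfun \<Rightarrow> jfun" where
  "zero_ext I f = (\<lambda>p. if p T \<in> I then f p else 0)"

lemma pd_zero_ext: "z \<noteq> T \<Longrightarrow> pd z (zero_ext I f) = zero_ext I (pd z f)"
  by (auto simp: pd_def zero_ext_def)

lemma Dx_zero_ext: "Dx (zero_ext I f) = zero_ext I (Dx f)"
  by (rule ext) (simp add: Dx_def pd_zero_ext, simp add: zero_ext_def)

lemma Dx_funpow_zero_ext: "(Dx ^^ k) (zero_ext I f) = zero_ext I ((Dx ^^ k) f)"
  by (induction k) (auto simp: Dx_zero_ext)

text \<open>The order is counted so that closure under products is an induction: the Leibniz rule
  turns one derivative of a product into products of functions regular to one order less.\<close>

primrec reg :: "nat \<Rightarrow> jfun \<Rightarrow> bool" where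
  "reg 0 f = True"
| "reg (Suc n) f = (xdiff f \<and> (\<forall>z. z \<noteq> T \<longrightarrow> reg n (pd z f)))"

lemma reg_Suc_imp: "reg (Suc n) f \<Longrightarrow> reg n f"
  by (induction n arbitrary: f) auto

lemma reg_add: "reg n f \<Longrightarrow> reg n g \<Longrightarrow> reg n (\<lambda>p. f p + g p)"
  by (induction n arbitrary: f g) (auto simp: xdiff_add pd_add)

lemma reg_mult: "reg n f \<Longrightarrow> reg n g \<Longrightarrow> reg n (\<lambda>p. f p * g p)"
proof (induction n arbitrary: f g)
  case (Suc n)
  then show ?case
    using reg_Suc_imp[OF Suc.prems(1)] reg_Suc_imp[OF Suc.prems(2)]
    by (auto simp: xdiff_mult pd_mult intro!: reg_add)
qed simp

lemma reg_coeff: "reg n (\<lambda>p. h (p T))"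
proof (induction n arbitrary: h)
  case (Suc n)
  show ?case using Suc[of "\<lambda>_. 0"] by (auto simp: xdiff_coeff pd_coeff)
qed simp

lemma reg_const: "reg n (\<lambda>p. k)"
  by (rule reg_coeff)

lemma reg_coord: "reg n (\<lambda>p. p w)"
  by (cases n) (auto simp: xdiff_coord pd_coord reg_const)

lemma reg_sum: "finite K \<Longrightarrow> (\<And>k. k \<in> K \<Longrightarrow> reg n (f k)) \<Longrightarrow> reg n (\<lambda>p. \<Sum>k\<in>K. f k p)"
  by (induction K rule: finite_induct) (auto simp: reg_const intro!: reg_add)

text \<open>A class closed under sums, products and \<open>Dx\<close> and blind to \<open>T\<close>,
  so it survives extension by zero outside \<open>I\<close>. The finite support keeps the sums in
  \<open>Dx\<close> finite.\<close>

definition xsmooth :: "jfun \<Rightarrow> bool" where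
  "xsmooth f \<longleftrightarrow> (\<forall>n. reg n f) \<and> (\<exists>S. finite S \<and> dep S f)"

lemma xsmoothD:
  assumes "xsmooth f" shows "adm f" "xdiff f"
proof -
  have "reg (Suc 0) f" using assms unfolding xsmooth_def by blast
  then show "adm f" "xdiff f" using assms by (simp_all add: xsmooth_def adm_def)
qed

lemma xsmooth_pd:
  assumes "xsmooth f" "z \<noteq> T" shows "xsmooth (pd z f)"
proof -
  have "reg (Suc n) f" for n using assms unfolding xsmooth_def by blast
  then have "reg n (pd z f)" for n using assms(2) by simp
  then show ?thesis using assms(1) unfolding xsmooth_def by (blast intro: dep_pd)
qed

lemma xsmooth_add: "xsmooth f \<Longrightarrow> xsmooth g \<Longrightarrow> xsmooth (\<lambda>p. f p + g p)"
  using adm_add[OF xsmoothD(1) xsmoothD(1), of f g] by (auto simp: xsmooth_def adm_def intro!: reg_add)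

lemma xsmooth_mult: "xsmooth f \<Longrightarrow> xsmooth g \<Longrightarrow> xsmooth (\<lambda>p. f p * g p)"
  using adm_mult[OF xsmoothD(1) xsmoothD(1), of f g] by (auto simp: xsmooth_def adm_def intro!: reg_mult)

lemma xsmooth_coeff: "xsmooth (\<lambda>p. h (p T))"
  using adm_coeff[of h] by (auto simp: xsmooth_def adm_def intro!: reg_coeff)

lemma xsmooth_coord: "xsmooth (\<lambda>p. p w)"
  using adm_coord[of w] by (auto simp: xsmooth_def adm_def intro!: reg_coord)

lemma xsmooth_Dx:
  assumes "xsmooth f" shows "xsmooth (Dx f)"
proof -
  obtain S K where K: "finite S" "dep S f" "finite K"
    "\<And>m n. U m n \<in> S \<Longrightarrow> (m, n) \<in> K" "\<And>m n. V m n \<in> S \<Longrightarrow> (m, n) \<in> K"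
    using common_support[of f f] xsmoothD(1)[OF assms] by metis
  have eq: "Dx f = (\<lambda>p. pd X f p + (\<Sum>(m, n)\<in>K. p (U (Suc m) n) * pd (U m n) f p)
                 + (\<Sum>(m, n)\<in>K. p (V (Suc m) n) * pd (V m n) f p))"
    by (rule Dx_eq_sum) (use K in auto)
  have r: "reg n (pd z f)" if "z \<noteq> T" for n z
    using xsmooth_pd[OF assms that] by (simp add: xsmooth_def)
  have "reg n (Dx f)" for n
    unfolding eq split_def using K(3)
    by (intro reg_add reg_sum reg_mult reg_coord r) auto
  moreover have "dep (S \<union> (\<lambda>(m, n). U (Suc m) n) ` K \<union> (\<lambda>(m, n). V (Suc m) n) ` K) (Dx f)"
    unfolding dep_def
  proof (intro allI impI)
    fix p q :: jet
    assume pq: "\<forall>z\<in>S \<union> (\<lambda>(m, n). U (Suc m) n) ` K \<union> (\<lambda>(m, n). V (Suc m) n) ` K. p z = q z"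
    have "pd z f p = pd z f q" for z
      using pq by (intro depD[OF dep_pd[OF K(2)]]) auto
    moreover have "p (U (Suc (fst k)) (snd k)) = q (U (Suc (fst k)) (snd k))"
      "p (V (Suc (fst k)) (snd k)) = q (V (Suc (fst k)) (snd k))" if "k \<in> K" for k
      using pq that by (force simp: split_def)+
    ultimately show "Dx f p = Dx f q"
      unfolding eq split_def
      by (intro arg_cong2[where f = "(+)"] arg_cong2[where f = "(*)"] sum.cong) auto
  qed
  ultimately show ?thesis
    unfolding xsmooth_def using K(1,3) by (intro conjI allI exI) auto
qed

lemma xsmooth_zero_ext:
  assumes "smooth_jfun (jets I) f" "finite S" "dep S f"
  shows "xsmooth (zero_ext I f)"
proof -
  have xd: "xdiff (zero_ext I (foldr pd zs f))" for zs
    unfolding xdiff_def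
  proof (intro allI impI)
    fix z p assume "z \<noteq> T"
    then show "(\<lambda>s. zero_ext I (foldr pd zs f) (p(z := s))) differentiable (at (p z))"
      using assms(1) by (cases "p T \<in> I") (auto simp: zero_ext_def smooth_jfun_def jets_def)
  qed
  have "reg n (zero_ext I (foldr pd zs f))" for n zs
  proof (induction n arbitrary: zs)
    case (Suc n)
    then show ?case using xd Suc[of "_ # zs"] by (auto simp: pd_zero_ext)
  qed simp
  from this[of _ "[]"] have "reg n (zero_ext I f)" for n by simp
  moreover have "dep (insert T S) (zero_ext I f)"
    using assms(3) by (auto simp: dep_def zero_ext_def)
  ultimately show ?thesis unfolding xsmooth_def using assms(2) by (intro conjI allI exI) auto
qed

section \<open>Filtration of jets by order in x\<close>

definition xtu :: "jcoord set" where "xtu = {X, T, U 0 0}"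

definition xjet :: "nat \<Rightarrow> jcoord set" where
  "xjet k = {X, T} \<union> (\<lambda>i. U i 0) ` {..k}"

lemma xjet_mono: "k \<le> l \<Longrightarrow> xjet k \<subseteq> xjet l"
  by (auto simp: xjet_def)

lemma xtu_eq_xjet: "xtu = xjet 0"
  by (simp add: xjet_def xtu_def insert_commute)

lemma Dx_xjet:
  assumes "dep (xjet k) f"
  shows "Dx f = (\<lambda>p. pd X f p + (\<Sum>i\<le>k. p (U (Suc i) 0) * pd (U i 0) f p))"
proof -
  have "(\<Sum>(m, n)\<in>{..k} \<times> {0}. p (V (Suc m) n) * pd (V m n) f p) = 0" for p
    using pd_notin[OF assms] by (intro sum.neutral) (auto simp: xjet_def)
  then show ?thesis
    by (subst Dx_eq_sum[OF assms, of "{..k} \<times> {0}"])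
      (auto simp: xjet_def sum.cartesian_product[symmetric])
qed

lemma dep_Dx:
  assumes "dep (xjet k) f" shows "dep (xjet (Suc k)) (Dx f)"
  unfolding dep_def
proof (intro allI impI)
  fix p q :: jet assume pq: "\<forall>z\<in>xjet (Suc k). p z = q z"
  have "pd z f p = pd z f q" for z
    using pq xjet_mono[of k "Suc k"] by (intro depD[OF dep_pd[OF assms]]) auto
  moreover have "p (U (Suc i) 0) = q (U (Suc i) 0)" if "i \<le> k" for i
    using pq that by (auto simp: xjet_def)
  ultimately show "Dx f p = Dx f q"
    unfolding Dx_xjet[OF assms] by (intro arg_cong2[where f = "(+)"] arg_cong2[where f = "(*)"] sum.cong) auto
qed

lemma dep_Dx_funpow: "dep xtu f \<Longrightarrow> dep (xjet k) ((Dx ^^ k) f)"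
  by (induction k) (auto simp: xtu_eq_xjet dep_Dx)

lemma Dx_xtu: "dep xtu f \<Longrightarrow> Dx f = (\<lambda>p. pd X f p + p (U 1 0) * pd (U 0 0) f p)"
  unfolding xtu_eq_xjet by (subst Dx_xjet) auto

lemma dep_coord: "w \<in> S \<Longrightarrow> dep S (\<lambda>p. p w)"
  by (simp add: dep_def)

lemma xsmooth_const: "xsmooth (\<lambda>p. k)"
  by (rule xsmooth_coeff)

lemma dep_const: "dep S (\<lambda>p. k)"
  by (simp add: dep_def)

text \<open>The new coordinate u_{k+1} occurs only in the last summand of the total derivative. The
  remainder is written as a difference to inherit smoothness from \<open>Dx W\<close>; its order is
  read off the explicit sum \<open>eq\<close>.\<close>

lemma Dx_split:
  assumes "xsmooth W" "dep (xjet k) W"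
  obtains W' where "xsmooth W'" "dep (xjet k) W'"
    "Dx W = (\<lambda>p. W' p + p (U (Suc k) 0) * pd (U k 0) W p)"
proof
  let ?W' = "\<lambda>p. Dx W p + (-1) * (p (U (Suc k) 0) * pd (U k 0) W p)"
  show "xsmooth ?W'"
    by (intro xsmooth_add xsmooth_mult xsmooth_Dx xsmooth_const xsmooth_coord xsmooth_pd assms) auto
  show "Dx W = (\<lambda>p. ?W' p + p (U (Suc k) 0) * pd (U k 0) W p)" by simp
  have eq: "?W' = (\<lambda>p. pd X W p + (\<Sum>i<k. p (U (Suc i) 0) * pd (U i 0) W p))"
    by (simp add: Dx_xjet[OF assms(2)] lessThan_Suc_atMost[symmetric])
  show "dep (xjet k) ?W'"
    unfolding dep_def
  proof (intro allI impI)
    fix p q :: jet assume pq: "\<forall>z\<in>xjet k. p z = q z"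
    have "pd z W p = pd z W q" for z
      using pq by (intro depD[OF dep_pd[OF assms(2)]]) auto
    moreover have "p (U (Suc i) 0) = q (U (Suc i) 0)" if "i < k" for i
      using pq that by (auto simp: xjet_def)
    ultimately show "?W' p = ?W' q"
      unfolding fun_cong[OF eq] by (intro arg_cong2[where f = "(+)"] arg_cong2[where f = "(*)"] sum.cong) auto
  qed
qed

text \<open>\<open>Dx\<close> turns u_k f_u into u_{k+1} f_u + u_k D_x(f_u), so from the third
  derivative on the coefficient of the second-highest coordinate gains \<open>e\<close> = D_x(f_u)
  each time. It ends as \<open>c2\<close> + 3 \<open>e\<close>, which would be 5 D_x(f_u) if the
  mixed derivatives were identified; they stay apart because \<open>xsmooth\<close> provides no
  continuity from which to derive symmetry.\<close>

lemma Dx5_leading_terms: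
  assumes f: "xsmooth f" "dep xtu f"
  obtains W where "dep (xjet 3) W"
    "(Dx ^^ 5) f = (\<lambda>p. W p + p (U 4 0) * (pd (U 0 0) (pd X f) p + 4 * pd X (pd (U 0 0) f) p
        + 5 * p (U 1 0) * pd (U 0 0) (pd (U 0 0) f) p) + p (U 5 0) * pd (U 0 0) f p)"
proof -
  let ?P = "pd X" and ?Q = "pd (U 0 0)"
  let ?u = "\<lambda>k p. p (U k 0) :: real"
  \<comment> \<open>\<open>S2\<close> is the part of D_x^2 f without u_xx, and \<open>c2\<close>
    will be its derivative in u_x. \<open>S2\<close> is quadratic in u_x, which is why the first
    steps do not follow the regular pattern.\<close>
  define S2 where "S2 = (\<lambda>p. ?P (?P f) p + (?u 1 p * ?Q (?P f) p + ?u 1 p * (?P (?Q f) p + ?u 1 p * ?Q (?Q f) p)))"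
  define e where "e = (\<lambda>p. ?P (?Q f) p + ?u 1 p * ?Q (?Q f) p)"
  define c2 where "c2 = (\<lambda>p. ?Q (?P f) p + (?P (?Q f) p + 2 * (?u 1 p * ?Q (?Q f) p)))"
  note dep = dep_pd[OF f(2)] dep_pd[OF dep_pd[OF f(2)]]
  have sm: "xsmooth (?P f)" "xsmooth (?Q f)" "xsmooth (?P (?P f))" "xsmooth (?Q (?P f))"
    "xsmooth (?P (?Q f))" "xsmooth (?Q (?Q f))"
    using f(1) by (simp_all add: xsmooth_pd)
  have smS2: "xsmooth S2" and sme: "xsmooth e" and smc: "xsmooth c2"
    unfolding S2_def e_def c2_def by (intro xsmooth_add xsmooth_mult xsmooth_const xsmooth_coord sm)+
  have d0: "dep (xjet 1) g" if "dep xtu g" for g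
    using that unfolding xtu_eq_xjet by (rule dep_mono) (simp add: xjet_mono)
  have u1: "dep (xjet 1) (?u 1)" by (simp add: dep_def xjet_def)
  have dS2: "dep (xjet 1) S2" and de: "dep (xjet 1) e" and dc: "dep (xjet 1) c2"
    unfolding S2_def e_def c2_def by (intro dep_add dep_mult dep_const u1 d0 dep)+
  have DQ: "Dx (?Q f) = e" by (simp add: Dx_xtu dep e_def)
  have DP: "Dx (?P f) = (\<lambda>p. ?P (?P f) p + ?u 1 p * ?Q (?P f) p)" by (simp add: Dx_xtu dep)
  have Du: "Dx (?u k) = ?u (Suc k)" for k by (rule Dx_U)
  have DuQ: "Dx (\<lambda>p. ?u k p * g p) = (\<lambda>p. ?u (Suc k) p * g p + ?u k p * Dx g p)" if "xsmooth g" for k g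
    using that by (simp add: Dx_mult adm_coord xsmoothD Du)
  have Da: "Dx (\<lambda>p. g p + h p) = (\<lambda>p. Dx g p + Dx h p)" if "xsmooth g" "xsmooth h" for g h
    using that by (simp add: Dx_add xsmoothD)
  have su: "xsmooth (\<lambda>p. ?u k p * g p)" if "xsmooth g" for k g
    using that by (intro xsmooth_mult xsmooth_coord)
  have D2: "Dx (Dx f) = (\<lambda>p. S2 p + ?u 2 p * ?Q f p)"
    by (simp add: Dx_xtu[OF f(2)] Da DuQ su sm DP DQ)
      (simp add: S2_def e_def numeral_2_eq_2 algebra_simps)
  have pdS2: "pd (U 1 0) S2 = c2"
    unfolding S2_def c2_def
    by (intro ext pd_eqI)
      (auto intro!: derivative_eq_intros
        simp: dep_fun_upd[OF dep(1)] dep_fun_upd[OF dep(2)] xtu_def)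
  obtain W3 where W3: "xsmooth W3" "dep (xjet 1) W3" "Dx S2 = (\<lambda>p. W3 p + ?u 2 p * c2 p)"
    using Dx_split[OF smS2 dS2] unfolding pdS2 by (metis numeral_2_eq_2 One_nat_def)
  define c3 where "c3 = (\<lambda>p. c2 p + e p)"
  have c3: "xsmooth c3" "dep (xjet 1) c3"
    unfolding c3_def by (intro xsmooth_add dep_add smc sme dc de)+
  have D3: "Dx (Dx (Dx f)) = (\<lambda>p. W3 p + (?u 2 p * c3 p + ?u 3 p * ?Q f p))"
    by (simp add: D2 Da smS2 su sm W3(3) DuQ DQ) (simp add: c3_def numeral_eq_Suc algebra_simps)
  define W4 where "W4 = (\<lambda>p. Dx W3 p + ?u 2 p * Dx c3 p)"
  define c4 where "c4 = (\<lambda>p. c3 p + e p)"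
  have D4: "Dx (Dx (Dx (Dx f))) = (\<lambda>p. W4 p + (?u 3 p * c4 p + ?u 4 p * ?Q f p))"
    by (simp add: D3 Da DuQ su sm W3 c3 xsmooth_add DQ)
      (simp add: W4_def c4_def numeral_eq_Suc algebra_simps)
  have smW4: "xsmooth W4" and smc4: "xsmooth c4"
    unfolding W4_def c4_def by (intro xsmooth_add xsmooth_Dx su W3 c3 sme)+
  define W where "W = (\<lambda>p. Dx W4 p + ?u 3 p * Dx c4 p)"
  have D5: "Dx (Dx (Dx (Dx (Dx f)))) = (\<lambda>p. W p + ?u 4 p * (c4 p + e p) + ?u 5 p * ?Q f p)"
    by (simp add: D4 Da DuQ su sm smW4 smc4 xsmooth_add DQ)
      (simp add: W_def numeral_eq_Suc algebra_simps)
  have u: "dep (xjet k) (?u k)" for k by (simp add: dep_def xjet_def)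
  have step: "dep (xjet k) g" if "dep (xjet j) g" "j \<le> k" for g j k
    using that dep_mono xjet_mono by blast
  have Dx: "dep (xjet k) (Dx g)" if "dep (xjet j) g" "Suc j \<le> k" for g j k
    using step[OF dep_Dx[OF that(1)] that(2)] .
  have "dep (xjet 2) W4"
    unfolding W4_def by (intro dep_add dep_mult u Dx[OF W3(2)] Dx[OF c3(2)]) auto
  moreover have "dep (xjet 1) c4"
    unfolding c4_def by (intro dep_add c3 de)
  ultimately have "dep (xjet 3) W"
    unfolding W_def by (intro dep_add dep_mult u) (auto intro: Dx)
  moreover have Dx5: "(Dx ^^ 5) f = Dx (Dx (Dx (Dx (Dx f))))"
    by (simp add: numeral_eq_Suc)
  have "(Dx ^^ 5) f = (\<lambda>p. W p + ?u 4 p * (?Q (?P f) p + 4 * ?P (?Q f) p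
        + 5 * ?u 1 p * ?Q (?Q f) p) + ?u 5 p * ?Q f p)"
    unfolding Dx5 D5 by (simp add: c4_def c3_def c2_def e_def algebra_simps)
  ultimately show ?thesis by (rule that)
qed

section \<open>Substitutions that are affine in \<open>u\<close>\<close>

lemma dep_singleton_T:
  assumes "dep {T} g" obtains h where "\<And>p. g p = h (p T)"
proof
  show "g p = g (\<lambda>_. p T)" for p
    by (rule depD[OF assms]) simp
qed

text \<open>The function is constant along every line in direction \<open>z\<close>. The whole line
  is available because \<open>xdiff\<close> speaks of all jets.\<close>

lemma pd_zero_imp_dep:
  assumes "xdiff f" "z \<noteq> T" "dep (insert z S) f" "\<And>p. pd z f p = 0"
  shows "dep S f"
  unfolding dep_def
proof (intro allI impI)
  fix p q :: jet assume pq: "\<forall>w\<in>S. p w = q w"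
  have "((\<lambda>s. f (p(z := s))) has_real_derivative 0) (at s)" for s
    using xdiffD[OF assms(1,2), of "p(z := s)"] assms(4) by simp
  then have "f (p(z := p z)) = f (p(z := q z))"
    by (intro DERIV_isconst_all[of "\<lambda>s. f (p(z := s))"]) auto
  also have "f (p(z := q z)) = f q"
    using pq by (intro depD[OF assms(3)]) auto
  finally show "f p = f q" by simp
qed

lemma Dx_XT:
  assumes "dep {X, T} f" shows "Dx f = pd X f"
  using Dx_eq_sum[OF assms, of "{}"] by auto

lemma Dx_funpow_XT:
  assumes "dep {X, T} f"
  shows "(Dx ^^ k) f = (pd X ^^ k) f" "dep {X, T} ((pd X ^^ k) f)"
  using assms by (induction k) (auto simp: Dx_XT dep_pd)

lemma xsmooth_pd_funpow: "xsmooth f \<Longrightarrow> z \<noteq> T \<Longrightarrow> xsmooth ((pd z ^^ k) f)"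
  by (induction k) (auto simp: xsmooth_pd)

lemma Dx_funpow_affine:
  assumes "xsmooth B" "dep {X, T} B"
  shows "(Dx ^^ k) (\<lambda>p. A (p T) * p (U 0 0) + B p) = (\<lambda>p. A (p T) * p (U k 0) + (pd X ^^ k) B p)"
proof (induction k)
  case (Suc k)
  have "adm ((pd X ^^ k) B)" "Dx ((pd X ^^ k) B) = pd X ((pd X ^^ k) B)"
    using xsmooth_pd_funpow[OF assms(1)] Dx_funpow_XT(2)[OF assms(2)]
    by (auto intro: xsmoothD Dx_XT)
  moreover have "Dx (\<lambda>p. A (p T) * p (U k 0)) = (\<lambda>p. A (p T) * p (U (Suc k) 0))"
    by (subst Dx_mult) (auto intro: adm_coord adm_coeff simp: Dx_U Dx_coeff)
  moreover have "adm (\<lambda>p. A (p T) * p (U k 0))"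
    by (intro adm_mult adm_coeff adm_coord)
  ultimately show ?case by (simp add: Suc Dx_add)
qed simp

text \<open>No symmetry of second derivatives is needed: once \<open>f\<close> is affine in \<open>u\<close>, its two mixed
  derivatives visibly agree.\<close>

lemma affine_if_second_derivatives:
  assumes f: "xsmooth f" "dep xtu f"
    and QQ: "\<And>p. pd (U 0 0) (pd (U 0 0) f) p = 0"
    and QP: "\<And>p. pd (U 0 0) (pd X f) p + 4 * pd X (pd (U 0 0) f) p = 0"
  obtains A B where "xsmooth B" "dep {X, T} B" "f = (\<lambda>p. A (p T) * p (U 0 0) + B p)"
proof -
  let ?q = "pd (U 0 0) f"
  have smq: "xsmooth ?q" using f(1) by (simp add: xsmooth_pd)
  have xtu: "xtu = insert (U 0 0) {X, T}" by (auto simp: xtu_def)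
  have q: "dep {X, T} ?q"
    by (rule pd_zero_imp_dep[of _ "U 0 0"]) (use smq xsmoothD dep_pd[OF f(2)] QQ in \<open>auto simp: xtu\<close>)
  \<comment> \<open>Removing u f_u leaves a function whose u-derivative vanishes, as f_u is free of
    u.\<close>
  define B where "B = (\<lambda>p. f p + (-1) * (?q p * p (U 0 0)))"
  have smB: "xsmooth B"
    unfolding B_def by (intro xsmooth_add xsmooth_mult xsmooth_const xsmooth_coord smq f)
  have "dep xtu B"
    unfolding B_def using f(2) by (intro dep_add dep_mult dep_const dep_coord dep_pd) (auto simp: xtu)
  moreover have "pd (U 0 0) B p = 0" for p
  proof -
    have "((\<lambda>s. f (p(U 0 0 := s)) + (-1) * (?q p * s)) has_real_derivative ?q p + (-1) * ?q p) (at (p (U 0 0)))"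
      by (auto intro!: derivative_eq_intros xdiffD xsmoothD f)
    then show ?thesis
      unfolding B_def by (intro pd_eqI) (simp add: dep_fun_upd[OF q])
  qed
  ultimately have B: "dep {X, T} B"
    using pd_zero_imp_dep[of B "U 0 0"] xsmoothD(2)[OF smB] by (simp add: xtu)
  have f_eq: "f = (\<lambda>p. ?q p * p (U 0 0) + B p)" by (simp add: B_def)
  have "pd X f = (\<lambda>p. (pd X ?q p * p (U 0 0) + ?q p * pd X (\<lambda>p. p (U 0 0)) p) + pd X B p)"
    by (subst f_eq) (simp add: pd_add pd_mult xdiff_mult xdiff_coord xsmoothD smq smB)
  then have Pf: "pd X f = (\<lambda>p. pd X ?q p * p (U 0 0) + pd X B p)" by (simp add: pd_coord)
  have "pd (U 0 0) (pd X f) p = pd X ?q p" for p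
  proof (rule pd_eqI)
    show "((\<lambda>s. pd X f (p(U 0 0 := s))) has_real_derivative pd X ?q p) (at (p (U 0 0)))"
      unfolding Pf using dep_fun_upd[OF dep_pd[OF q]] dep_fun_upd[OF dep_pd[OF B]]
      by (auto intro!: derivative_eq_intros)
  qed
  \<comment> \<open>With the mixed derivatives equal, \<open>QP\<close> becomes 5 times this
    derivative.\<close>
  then have "pd X ?q p = 0" for p using QP[of p] by simp
  then have "dep {T} ?q"
    using pd_zero_imp_dep[of ?q X] xsmoothD(2)[OF smq] q by simp
  then obtain A where "\<And>p. ?q p = A (p T)" using dep_singleton_T by blast
  then have "f = (\<lambda>p. A (p T) * p (U 0 0) + B p)" using f_eq by simp
  with smB B show ?thesis by (rule that)
qed

lemma dep_lift: "dep xtu (lift \<phi>)"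
  by (simp add: dep_def lift_def xtu_def)

lemma Dt_xtu:
  assumes "dep xtu f"
  shows "Dt f = (\<lambda>p. pd T f p + p (U 0 1) * pd (U 0 0) f p)"
proof
  fix p
  have z: "pd (U m n) f p = 0" if "(m, n) \<noteq> (0, 0)" for m n
    using that by (intro pd_notin[OF assms]) (auto simp: xtu_def)
  have "Sum_any (\<lambda>(m, n). p (U m (Suc n)) * pd (U m n) f p)
      = (\<Sum>(m, n)\<in>{(0, 0)}. p (U m (Suc n)) * pd (U m n) f p)"
  proof (rule Sum_any.expand_superset)
    show "{k. (case k of (m, n) \<Rightarrow> p (U m (Suc n)) * pd (U m n) f p) \<noteq> 0} \<subseteq> {(0, 0)}"
      (is "?S \<subseteq> _")
    proof
      fix k assume "k \<in> ?S"
      then show "k \<in> {(0, 0)}"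
        using z[of "fst k" "snd k"] by (cases "k = (0, 0)") (simp_all add: case_prod_unfold)
    qed
  qed simp
  then show "Dt f p = pd T f p + p (U 0 1) * pd (U 0 0) f p"
    using pd_notin[OF assms, of "V _ _"] by (simp add: Dt_def xtu_def)
qed

text \<open>The x- and u-derivatives are taken of the extension \<open>f\<close>, where the global
  calculus applies; the t-derivative remains with \<open>lift \<phi>\<close>, since
  \<open>pd_zero_ext\<close> does not cover \<open>T\<close>.\<close>

lemma subst_adjoint_evolution5:
  fixes \<phi> p I
  defines "f \<equiv> zero_ext I (lift \<phi>)"
  assumes "p \<in> jets I"
  shows "subst_v \<phi> (adjoint_eq (evolution5 a b c d)) p =
     - (pd T (lift \<phi>) p + p (U 0 1) * pd (U 0 0) f p)
     + ((b (p T) - 3 * a (p T)) * p (U 2 0) - c (p T) * (p (U 0 0))\<^sup>2) * Dx f p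
     + (b (p T) - 3 * a (p T)) * p (U 1 0) * (Dx ^^ 2) f p - a (p T) * p (U 0 0) * (Dx ^^ 3) f p
     - d (p T) * (Dx ^^ 5) f p"
proof -
  have e: "zero_ext I g p = g p" for g
    using assms(2) by (simp add: zero_ext_def jets_def)
  show ?thesis
    unfolding f_def Dx_funpow_zero_ext Dx_zero_ext e
    by (simp add: subst_v_def adjoint_evolution5 e Dt_xtu[OF dep_lift] pd_zero_ext)
qed

text \<open>Adding A F cancels the A-terms in u_t, u_xxxxx, u u_xxx and u^2 u_x. Those in u_x u_xx
  add up to 2(b - 3a) + b = 3(b - 2a).\<close>

lemma subst_adjoint_affine:
  assumes "p \<in> jets I" "zero_ext I (lift \<phi>) = (\<lambda>p. A (p T) * p (U 0 0) + B p)"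
    and "xsmooth B" "dep {X, T} B"
  shows "subst_v \<phi> (adjoint_eq (evolution5 a b c d)) p + A (p T) * evolution5 a b c d p =
     - pd T (lift \<phi>) p + 3 * A (p T) * (b (p T) - 2 * a (p T)) * p (U 1 0) * p (U 2 0)
     + ((b (p T) - 3 * a (p T)) * p (U 2 0) - c (p T) * (p (U 0 0))\<^sup>2) * pd X B p
     + (b (p T) - 3 * a (p T)) * p (U 1 0) * (pd X ^^ 2) B p - a (p T) * p (U 0 0) * (pd X ^^ 3) B p
     - d (p T) * (pd X ^^ 5) B p"
proof -
  have "pd (U 0 0) (\<lambda>p. A (p T) * p (U 0 0) + B p) p = A (p T)"
    using dep_fun_upd[OF assms(4)] by (intro pd_eqI) (auto intro!: derivative_eq_intros)
  moreover have "Dx (\<lambda>p. A (p T) * p (U 0 0) + B p) p = A (p T) * p (U 1 0) + pd X B p"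
    using Dx_funpow_affine[OF assms(3,4), of 1] by simp
  ultimately show ?thesis
    unfolding subst_adjoint_evolution5[OF assms(1)] assms(2) Dx_funpow_affine[OF assms(3,4)]
    by (simp add: evolution5_def power2_eq_square algebra_simps)
qed

section \<open>The determining equations\<close>

lemma coord_notin_xjet [simp]:
  "U m (Suc n) \<notin> xjet k" "U m 0 \<in> xjet k \<longleftrightarrow> m \<le> k"
  by (auto simp: xjet_def)

lemma xsmooth_zero_ext_lift: "smooth_xtu I \<phi> \<Longrightarrow> xsmooth (zero_ext I (lift \<phi>))"
  unfolding smooth_xtu_def by (erule xsmooth_zero_ext[OF _ _ dep_lift]) (simp add: xtu_def)

lemma dep_zero_ext_lift: "dep xtu (zero_ext I (lift \<phi>))"
  by (auto simp: dep_def zero_ext_def lift_def xtu_def)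

text \<open>When F is u_t plus terms free of u_t, this is a projection onto the jets with F = 0 that
  moves only u_t.\<close>

definition u_t_solved :: "jfun \<Rightarrow> jet \<Rightarrow> jet" where
  "u_t_solved F p = p(U 0 1 := p (U 0 1) - F p)"

lemma evolution5_u_t_solved: "evolution5 a b c d (u_t_solved (evolution5 a b c d) p) = 0"
  by (simp add: u_t_solved_def evolution5_def)

text \<open>The unknown multiplier drops out where F = 0, whatever its form. Necessity uses the
  identity only through this consequence.\<close>

lemma subst_adjoint_u_t_solved:
  assumes "adjoint_identity I (evolution5 a b c d) \<phi>" "p \<in> jets I"
  shows "subst_v \<phi> (adjoint_eq (evolution5 a b c d)) (u_t_solved (evolution5 a b c d) p) = 0"
proof -
  have "u_t_solved (evolution5 a b c d) p \<in> jets I"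
    using assms(2) by (simp add: u_t_solved_def jets_def)
  then show ?thesis
    using assms(1) unfolding adjoint_identity_def by (auto simp: evolution5_u_t_solved)
qed

text \<open>Two jets on F = 0 that differ by 1 in u_xxxx are compared. All ingredients of F^* except
  D_x^5 phi agree on them, and d \<noteq> 0 isolates the coefficient.\<close>

lemma adjoint_identity_second_derivatives:
  fixes a b c d :: "real \<Rightarrow> real" and \<phi> I
  defines "f \<equiv> zero_ext I (lift \<phi>)"
  assumes sm: "smooth_xtu I \<phi>" and adj: "adjoint_identity I (evolution5 a b c d) \<phi>"
    and d: "\<forall>t\<in>I. d t \<noteq> 0" and p: "p \<in> jets I"
  shows "pd (U 0 0) (pd X f) p + 4 * pd X (pd (U 0 0) f) p
     + 5 * p (U 1 0) * pd (U 0 0) (pd (U 0 0) f) p = 0"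
proof -
  let ?F = "evolution5 a b c d"
  have f: "xsmooth f" "dep xtu f"
    unfolding f_def by (rule xsmooth_zero_ext_lift[OF sm], rule dep_zero_ext_lift)
  obtain W where W: "dep (xjet 3) W"
    "(Dx ^^ 5) f = (\<lambda>p. W p + p (U 4 0) * (pd (U 0 0) (pd X f) p + 4 * pd X (pd (U 0 0) f) p
        + 5 * p (U 1 0) * pd (U 0 0) (pd (U 0 0) f) p) + p (U 5 0) * pd (U 0 0) f p)"
    using Dx5_leading_terms[OF f] by blast
  define p0 where "p0 = u_t_solved ?F p"
  define p1 where "p1 = u_t_solved ?F (p(U 4 0 := p (U 4 0) + 1))"
  have p0: "p0 = p(U 0 1 := p (U 0 1) - ?F p)"
    by (simp add: p0_def u_t_solved_def)
  have p1: "p1 = p0(U 4 0 := p0 (U 4 0) + 1)"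
    by (simp add: p0_def p1_def u_t_solved_def evolution5_def fun_upd_twist)
  have jets: "p0 \<in> jets I" "p1 \<in> jets I"
    using p by (simp_all add: p0 p1 jets_def)
  have same: "g p1 = g p0" if "dep (xjet 3) g" for g
    unfolding p1 by (rule dep_fun_upd[OF that]) simp
  have xtu: "dep (xjet 3) g" if "dep xtu g" for g
    using that unfolding xtu_eq_xjet by (rule dep_mono) (simp add: xjet_mono)
  have Dx: "dep (xjet 3) ((Dx ^^ k) f)" if "k \<le> 3" for k
    using dep_Dx_funpow[OF f(2)] by (rule dep_mono) (simp add: xjet_mono that)
  have eqs: "pd T (lift \<phi>) p1 = pd T (lift \<phi>) p0" "pd (U 0 0) f p1 = pd (U 0 0) f p0"
    "Dx f p1 = Dx f p0" "(Dx ^^ 2) f p1 = (Dx ^^ 2) f p0" "(Dx ^^ 3) f p1 = (Dx ^^ 3) f p0"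
    using Dx[of 1] by (simp_all add: same Dx xtu dep_pd f dep_lift)
  have "subst_v \<phi> (adjoint_eq ?F) p0 = 0" "subst_v \<phi> (adjoint_eq ?F) p1 = 0"
    unfolding p0_def p1_def using p by (auto intro!: subst_adjoint_u_t_solved[OF adj] simp: jets_def)
  moreover have "p1 z = p0 z" if "z \<noteq> U 4 0" for z
    using that by (simp add: p1)
  ultimately have "d (p0 T) * (Dx ^^ 5) f p1 = d (p0 T) * (Dx ^^ 5) f p0"
    unfolding subst_adjoint_evolution5[OF jets(1)]
      subst_adjoint_evolution5[OF jets(2)] f_def[symmetric] eqs by auto
  moreover have "d (p0 T) \<noteq> 0" using jets(1) d by (auto simp: jets_def)
  ultimately have eq: "(Dx ^^ 5) f p1 = (Dx ^^ 5) f p0" by simp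
  define E where "E = (\<lambda>p. pd (U 0 0) (pd X f) p + 4 * pd X (pd (U 0 0) f) p
     + 5 * p (U 1 0) * pd (U 0 0) (pd (U 0 0) f) p)"
  have E: "dep (xjet 3) E"
    unfolding E_def by (intro dep_add dep_mult dep_const dep_coord xtu dep_pd f) simp
  have "W p1 + p1 (U 4 0) * E p1 + p1 (U 5 0) * pd (U 0 0) f p1
      = W p0 + p0 (U 4 0) * E p0 + p0 (U 5 0) * pd (U 0 0) f p0"
    using eq unfolding W(2) E_def .
  then have "E p0 = 0"
    unfolding same[OF W(1)] same[OF E] eqs by (simp add: p1 algebra_simps)
  moreover have "E p0 = E p"
    unfolding p0 by (rule dep_fun_upd[OF E]) simp
  ultimately show ?thesis by (simp add: E_def)
qed

lemma adjoint_identity_imp_affine: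
  fixes a b c d :: "real \<Rightarrow> real"
  assumes sm: "smooth_xtu I \<phi>" and adj: "adjoint_identity I (evolution5 a b c d) \<phi>"
    and d: "\<forall>t\<in>I. d t \<noteq> 0"
  obtains A B where "xsmooth B" "dep {X, T} B"
    "zero_ext I (lift \<phi>) = (\<lambda>p. A (p T) * p (U 0 0) + B p)"
proof -
  let ?f = "zero_ext I (lift \<phi>)"
  let ?E = "\<lambda>p. pd (U 0 0) (pd X ?f) p + 4 * pd X (pd (U 0 0) ?f) p"
  let ?Q = "pd (U 0 0) (pd (U 0 0) ?f)"
  note f = xsmooth_zero_ext_lift[OF sm] dep_zero_ext_lift
  have E: "dep xtu ?E" and Q: "dep xtu ?Q"
    by (intro dep_add dep_mult dep_const dep_pd f)+
  have "?E p = 0 \<and> ?Q p = 0" for p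
  proof (cases "p \<in> jets I")
    case True
    \<comment> \<open>Neither \<open>?E\<close> nor \<open>?Q\<close> involves u_x, so its value can
      be replaced by any s; s = 0 and s = 1 then separate the two.\<close>
    have "?E p + 5 * s * ?Q p = 0" for s
    proof -
      have "?E (p(U 1 0 := s)) + 5 * s * ?Q (p(U 1 0 := s)) = 0"
        using adjoint_identity_second_derivatives[OF sm adj d, of "p(U 1 0 := s)"] True
        by (simp add: jets_def)
      then show ?thesis
        using dep_fun_upd[OF E, of "U 1 0" p s] dep_fun_upd[OF Q, of "U 1 0" p s]
        by (simp add: xtu_def)
    qed
    from this[of 0] this[of 1] show ?thesis by simp
  next
    case False
    then show ?thesis by (simp add: pd_zero_ext) (simp add: zero_ext_def jets_def)
  qed
  then show ?thesis
    using affine_if_second_derivatives[OF f] that by blast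
qed

definition base_jet :: "real \<Rightarrow> real \<Rightarrow> real \<Rightarrow> real \<Rightarrow> real \<Rightarrow> jet" where
  "base_jet x t u y z = (\<lambda>_. 0)(X := x, T := t, U 0 0 := u, U 1 0 := y, U 2 0 := z)"

text \<open>Passage from jets to ordinary calculus. The parameters y, z stand for u_x, u_xx and
  occur only in the value of the t-derivative; uniqueness of derivatives then yields one equation
  per coefficient.\<close>

lemma determining_equations:
  fixes a b c d :: "real \<Rightarrow> real"
  assumes sm: "smooth_xtu I \<phi>" and adj: "adjoint_identity I (evolution5 a b c d) \<phi>"
    and d: "\<forall>t\<in>I. d t \<noteq> 0"
  obtains A :: "real \<Rightarrow> real" and B :: "nat \<Rightarrow> real \<Rightarrow> real \<Rightarrow> real" where
    "\<And>x t u. t \<in> I \<Longrightarrow> \<phi> x t u = A t * u + B 0 x t"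
    "\<And>k x t. ((\<lambda>x. B k x t) has_real_derivative B (Suc k) x t) (at x)"
    "\<And>x t u y z. t \<in> I \<Longrightarrow> ((\<lambda>t. \<phi> x t u) has_real_derivative
        3 * A t * (b t - 2 * a t) * y * z + ((b t - 3 * a t) * z - c t * u\<^sup>2) * B 1 x t
        + (b t - 3 * a t) * y * B 2 x t - a t * u * B 3 x t - d t * B 5 x t) (at t)"
proof -
  obtain A B where B: "xsmooth B" "dep {X, T} B"
    and aff: "zero_ext I (lift \<phi>) = (\<lambda>p. A (p T) * p (U 0 0) + B p)"
    using adjoint_identity_imp_affine[OF sm adj d] by metis
  let ?B = "\<lambda>k x t. (pd X ^^ k) B (base_jet x t 0 0 0)"
  have B_base: "(pd X ^^ k) B (base_jet x t u y z) = ?B k x t" for k x t u y z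
    by (rule depD[OF Dx_funpow_XT(2)[OF B(2)]]) (auto simp: base_jet_def)
  show ?thesis
  proof
    fix x t u assume "t \<in> I"
    then show "\<phi> x t u = A t * u + ?B 0 x t"
      using fun_cong[OF aff, of "base_jet x t u 0 0"] B_base[of 0 x t u 0 0]
      by (simp add: zero_ext_def lift_def base_jet_def)
  next
    fix k x t
    have "((\<lambda>s. (pd X ^^ k) B ((base_jet x t 0 0 0)(X := s))) has_real_derivative
        pd X ((pd X ^^ k) B) (base_jet x t 0 0 0)) (at (base_jet x t 0 0 0 X))"
      using xsmoothD(2)[OF xsmooth_pd_funpow[OF B(1)]] by (intro xdiffD) auto
    moreover have "(base_jet x t 0 0 0)(X := s) = base_jet s t 0 0 0" for s
      by (auto simp: base_jet_def)
    ultimately show "((\<lambda>x. ?B k x t) has_real_derivative ?B (Suc k) x t) (at x)"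
      by (simp add: base_jet_def)
  next
    fix x t u y z assume t: "t \<in> I"
    let ?p = "base_jet x t u y z"
    \<comment> \<open>Moving to F = 0 removes A F from \<open>subst_adjoint_affine\<close>; the
      remaining terms do not see u_t.\<close>
    let ?p' = "u_t_solved (evolution5 a b c d) ?p"
    have jets: "?p \<in> jets I" "?p' \<in> jets I"
      using t by (simp_all add: base_jet_def jets_def u_t_solved_def)
    have upd: "(base_jet x t u y z)(T := s) = base_jet x s u y z" for s
      by (auto simp: base_jet_def)
    have "(\<lambda>s. lift \<phi> (?p(T := s))) differentiable (at (?p T))"
      using sm jets(1) unfolding smooth_xtu_def smooth_jfun_def
      by (metis foldr.simps(1) id_apply)
    then have DERIV: "((\<lambda>s. \<phi> x s u) has_real_derivative pd T (lift \<phi>) ?p) (at t)"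
      unfolding pd_def upd real_differentiable_def
      by (auto simp: lift_def base_jet_def DERIV_imp_deriv)
    have "pd T (lift \<phi>) ?p = pd T (lift \<phi>) ?p'"
      unfolding u_t_solved_def
      by (rule dep_fun_upd[OF dep_pd[OF dep_lift], symmetric]) (simp add: xtu_def)
    moreover have "(pd X ^^ k) B ?p' = ?B k x t" for k
      unfolding u_t_solved_def B_base[of k x t u y z, symmetric]
      by (rule dep_fun_upd[OF Dx_funpow_XT(2)[OF B(2)]]) simp
    note this[of 1] this[of 2] this[of 3] this[of 5]
    moreover have "?p' T = t" "?p' (U 0 0) = u" "?p' (U 1 0) = y" "?p' (U 2 0) = z"
      by (simp_all add: u_t_solved_def base_jet_def)
    moreover note subst_adjoint_affine[OF jets(2) aff B, of a b c d]
    ultimately have "pd T (lift \<phi>) ?p =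
        3 * A t * (b t - 2 * a t) * y * z + ((b t - 3 * a t) * z - c t * u\<^sup>2) * ?B 1 x t
        + (b t - 3 * a t) * y * ?B 2 x t - a t * u * ?B 3 x t - d t * ?B 5 x t"
      by (simp add: subst_adjoint_u_t_solved[OF adj jets(1)] evolution5_u_t_solved)
    with DERIV show "((\<lambda>t. \<phi> x t u) has_real_derivative
        3 * A t * (b t - 2 * a t) * y * z + ((b t - 3 * a t) * z - c t * u\<^sup>2) * ?B 1 x t
        + (b t - 3 * a t) * y * ?B 2 x t - a t * u * ?B 3 x t - d t * ?B 5 x t) (at t)"
      by simp
  qed
qed

section \<open>Classification of the substitutions\<close>

text \<open>A family closed under every \<open>pd\<close> and containing all substitutions, so
  iterated derivatives reduce to bookkeeping of four coefficients.\<close>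

definition quad_jfun :: "real \<Rightarrow> real \<Rightarrow> real \<Rightarrow> real \<Rightarrow> jfun" where
  "quad_jfun \<alpha> \<beta> \<gamma> \<delta> = (\<lambda>p. \<alpha> * (p X)\<^sup>2 + \<beta> * p X + \<gamma> * p (U 0 0) + \<delta>)"

lemma quad_jfun_zero: "quad_jfun 0 0 0 0 = (\<lambda>p. 0)"
  by (simp add: quad_jfun_def)

lemma has_real_derivative_quad_jfun:
  "((\<lambda>s. quad_jfun \<alpha> \<beta> \<gamma> \<delta> (p(z := s))) has_real_derivative
      (if z = X then 2 * \<alpha> * p X + \<beta> else if z = U 0 0 then \<gamma> else 0)) (at (p z))"
  unfolding quad_jfun_def by (auto intro!: derivative_eq_intros)

lemma pd_quad_jfun:
  "pd z (quad_jfun \<alpha> \<beta> \<gamma> \<delta>) =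
     (if z = X then quad_jfun 0 (2 * \<alpha>) 0 \<beta> else if z = U 0 0 then quad_jfun 0 0 0 \<gamma> else quad_jfun 0 0 0 0)"
  by (intro ext pd_eqI DERIV_cong[OF has_real_derivative_quad_jfun]) (auto simp: quad_jfun_def)

lemma eventually_upd_jets:
  assumes "open I" "p \<in> jets I"
  shows "\<forall>\<^sub>F s in nhds (p z). p(z := s) \<in> jets I"
proof (cases "z = T")
  case True
  then show ?thesis
    using eventually_nhds_in_open[OF assms(1), of "p T"] assms(2) by (simp add: jets_def)
next
  case False
  then show ?thesis using assms(2) by (simp add: jets_def)
qed

text \<open>Agreement on \<open>jets I\<close> passes to partial derivatives, in \<open>T\<close>
  too, because \<open>I\<close> is open; values elsewhere are arbitrary.\<close>

lemma smooth_jfun_quad: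
  assumes "open I" and f: "\<And>p. p \<in> jets I \<Longrightarrow> f p = quad_jfun \<alpha> \<beta> \<gamma> \<delta> p"
  shows "smooth_jfun (jets I) f"
proof -
  have ev: "\<forall>\<^sub>F s in nhds (p z). g (p(z := s)) = h (p(z := s))"
    if "p \<in> jets I" "\<And>p. p \<in> jets I \<Longrightarrow> g p = h p" for g h :: jfun and p z
    using eventually_upd_jets[OF assms(1) that(1)] by eventually_elim (rule that(2))
  have closed: "\<exists>\<alpha> \<beta> \<gamma> \<delta>. \<forall>p\<in>jets I. foldr pd zs f p = quad_jfun \<alpha> \<beta> \<gamma> \<delta> p" for zs
  proof (induction zs)
    case Nil
    then show ?case using f by auto
  next
    case (Cons z zs)
    then obtain \<alpha> \<beta> \<gamma> \<delta> where IH: "\<And>p. p \<in> jets I \<Longrightarrow> foldr pd zs f p = quad_jfun \<alpha> \<beta> \<gamma> \<delta> p"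
      by auto
    have "foldr pd (z # zs) f p = pd z (quad_jfun \<alpha> \<beta> \<gamma> \<delta>) p" if "p \<in> jets I" for p
      unfolding foldr.simps o_apply pd_def[of z] by (rule deriv_cong_ev[OF ev[OF that IH] refl])
    then show ?case unfolding pd_quad_jfun by (auto split: if_splits)
  qed
  show ?thesis
    unfolding smooth_jfun_def
  proof (intro allI conjI ballI)
    fix zs
    obtain \<alpha> \<beta> \<gamma> \<delta> where eq: "\<And>p. p \<in> jets I \<Longrightarrow> foldr pd zs f p = quad_jfun \<alpha> \<beta> \<gamma> \<delta> p"
      using closed by blast
    have "continuous_on (jets I) (quad_jfun \<alpha> \<beta> \<gamma> \<delta>)"
      unfolding quad_jfun_def
      by (intro continuous_intros continuous_on_product_then_coordinatewise continuous_on_id)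
    then show "continuous_on (jets I) (foldr pd zs f)"
      using eq by (simp cong: continuous_on_cong)
    fix z p assume p: "p \<in> jets I"
    show "(\<lambda>s. foldr pd zs f (p(z := s))) differentiable at (p z)"
      using DERIV_cong_ev[OF refl ev[where g = "foldr pd zs f", OF p eq] refl, of z]
        has_real_derivative_quad_jfun[of \<alpha> \<beta> \<gamma> \<delta> p z]
      unfolding real_differentiable_def by blast
  qed
qed

lemma quadratic_affine_is_substitution:
  assumes I: "open I" and \<phi>: "\<And>x t u. t \<in> I \<Longrightarrow> \<phi> x t u = \<alpha> * x\<^sup>2 + \<beta> * x + \<gamma> * u + \<delta>"
    and cond: "\<gamma> = 0 \<or> (\<forall>t\<in>I. b t = 2 * a t)"
      "\<alpha> = 0 \<and> \<beta> = 0 \<or> (\<forall>t\<in>I. b t = 3 * a t \<and> c t = 0)"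
  shows "smooth_xtu I \<phi>" "adjoint_identity I (evolution5 a b c d) \<phi>"
proof -
  let ?F = "evolution5 a b c d"
  have lift: "lift \<phi> p = quad_jfun \<alpha> \<beta> \<gamma> \<delta> p" if "p \<in> jets I" for p
    using that \<phi> by (simp add: lift_def quad_jfun_def jets_def)
  then show "smooth_xtu I \<phi>"
    unfolding smooth_xtu_def by (rule smooth_jfun_quad[OF I])
  \<comment> \<open>Both \<open>A\<close> and \<open>B\<close> vanish off \<open>I\<close>, to match
    \<open>zero_ext\<close>.\<close>
  define A where "A t = (if t \<in> I then \<gamma> else 0)" for t
  define B where "B = zero_ext I (quad_jfun \<alpha> \<beta> 0 \<delta>)"
  have smB: "xsmooth B"
    unfolding B_def
    by (rule xsmooth_zero_ext[OF smooth_jfun_quad[OF I refl], of "{X}"]) (auto simp: dep_def quad_jfun_def)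
  have depB: "dep {X, T} B"
    by (auto simp: B_def dep_def zero_ext_def quad_jfun_def)
  have aff: "zero_ext I (lift \<phi>) = (\<lambda>p. A (p T) * p (U 0 0) + B p)"
    by (auto simp: zero_ext_def A_def B_def lift quad_jfun_def jets_def)
  show "adjoint_identity I ?F \<phi>"
    unfolding adjoint_identity_def
  proof (intro exI conjI ballI)
    show "differential_function I (\<lambda>p. - \<gamma>)"
      unfolding differential_function_def
      by (intro conjI exI[of _ "{}"] smooth_jfun_quad[OF I, of _ 0 0 0 "- \<gamma>"])
        (auto simp: quad_jfun_def)
    fix p assume p: "p \<in> jets I"
    then have t: "p T \<in> I" by (simp add: jets_def)
    have "pd T (lift \<phi>) p = pd T (quad_jfun \<alpha> \<beta> \<gamma> \<delta>) p"
      unfolding pd_def using eventually_upd_jets[OF I p, of T]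
      by (intro deriv_cong_ev) (auto elim!: eventually_mono simp: lift)
    then have T: "pd T (lift \<phi>) p = 0"
      by (simp add: pd_quad_jfun quad_jfun_zero)
    have B: "pd X B p = 2 * \<alpha> * p X + \<beta>" "(pd X ^^ 2) B p = 2 * \<alpha>" "(pd X ^^ 3) B p = 0"
      "(pd X ^^ 5) B p = 0"
      using t by (simp_all add: B_def pd_zero_ext pd_quad_jfun numeral_eq_Suc)
        (simp_all add: zero_ext_def quad_jfun_def)
    have "subst_v \<phi> (adjoint_eq ?F) p + A (p T) * ?F p = 0"
      unfolding subst_adjoint_affine[OF p aff smB depB] T B
      using cond t by (auto simp: A_def)
    then show "subst_v \<phi> (adjoint_eq ?F) p = - \<gamma> * ?F p"
      using t by (simp add: A_def)
  qed
qed

section \<open>From the determining equations to the quadratic family\<close>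

lemma DERIV_zero_if_zero_on_open:
  fixes f :: "real \<Rightarrow> real"
  assumes "open I" "t \<in> I" "\<And>s. s \<in> I \<Longrightarrow> f s = 0" "(f has_real_derivative D) (at t)"
  shows "D = 0"
proof -
  have "((\<lambda>s. 0) has_real_derivative D) (at t)"
    by (rule has_field_derivative_transform_within_open[OF assms(4,1,2)]) (simp add: assms(3))
  then show ?thesis using DERIV_const DERIV_unique by blast
qed

lemma DERIV_tower_zero:
  fixes B :: "nat \<Rightarrow> real \<Rightarrow> real"
  assumes "\<And>k x. (B k has_real_derivative B (Suc k) x) (at x)" "\<And>x. B j x = 0" "j \<le> k"
  shows "B k x = 0"
  using assms(3)
proof (induction k arbitrary: x rule: dec_induct)
  case (step k)
  have "((\<lambda>x. 0) has_real_derivative B (Suc k) x) (at x)"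
    using assms(1)[of k x] step.IH by (simp add: ext[of "B k" "\<lambda>_. 0"])
  then show ?case using DERIV_const DERIV_unique by blast
qed (rule assms(2))

lemma quadratic_if_third_derivative_zero:
  fixes B :: "nat \<Rightarrow> real \<Rightarrow> real"
  assumes D: "\<And>k x. (B k has_real_derivative B (Suc k) x) (at x)" and "\<And>x. B 3 x = 0"
  shows "B 0 x = B 2 0 / 2 * x\<^sup>2 + B 1 0 * x + B 0 0"
proof -
  have 2: "B 2 x = B 2 0" for x
    using D[of 2] assms(2) by (intro DERIV_isconst_all[of "B 2"]) (simp add: eval_nat_numeral)
  have "((\<lambda>x. B 1 x - B 2 0 * x) has_real_derivative B 2 x - B 2 0) (at x)" for x
    using D[of 1 x] by (auto intro!: derivative_eq_intros simp: numeral_2_eq_2)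
  moreover have "B 2 x - B 2 0 = 0" for x
    using 2[of x] by linarith
  ultimately have "((\<lambda>x. B 1 x - B 2 0 * x) has_real_derivative 0) (at x)" for x
    by (simp only:)
  then have 1: "B 1 x = B 2 0 * x + B 1 0" for x
    using DERIV_isconst_all[of "\<lambda>x. B 1 x - B 2 0 * x" x 0] by simp
  have "((\<lambda>x. B 0 x - (B 2 0 / 2 * x\<^sup>2 + B 1 0 * x)) has_real_derivative
          B 1 x - (B 2 0 * x + B 1 0)) (at x)" for x
    using D[of 0 x] by (auto intro!: derivative_eq_intros)
  moreover have "B 1 x - (B 2 0 * x + B 1 0) = 0" for x
    using 1[of x] by linarith
  ultimately have "((\<lambda>x. B 0 x - (B 2 0 / 2 * x\<^sup>2 + B 1 0 * x)) has_real_derivative 0) (at x)" for x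
    by (simp only:)
  then show ?thesis
    using DERIV_isconst_all[of "\<lambda>x. B 0 x - (B 2 0 / 2 * x\<^sup>2 + B 1 0 * x)" x 0] by simp
qed

text \<open>One classification behind all five types. \<open>alt\<close> forbids a time with b = 3a,
  c = 0 together with a time with b = 2a. For a = b = c = 0 the equation is linear, and every
  solution of phi_t + d phi_xxxxx = 0 in x and t alone would be a substitution.\<close>

lemma substitution_iff:
  fixes I :: "real set" and a b c d :: "real \<Rightarrow> real"
  assumes I: "open I" "is_interval I" "I \<noteq> {}" and d: "\<forall>t\<in>I. d t \<noteq> 0"
    and alt: "(\<forall>t\<in>I. b t \<noteq> 3 * a t \<or> c t \<noteq> 0) \<or> (\<forall>t\<in>I. b t \<noteq> 2 * a t)"
  shows "smooth_xtu I \<phi> \<and> adjoint_identity I (evolution5 a b c d) \<phi> \<longleftrightarrow>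
    (\<exists>\<alpha> \<beta> \<gamma> \<delta>. (\<forall>x. \<forall>t\<in>I. \<forall>u. \<phi> x t u = \<alpha> * x\<^sup>2 + \<beta> * x + \<gamma> * u + \<delta>)
      \<and> (\<gamma> = 0 \<or> (\<forall>t\<in>I. b t = 2 * a t))
      \<and> (\<alpha> = 0 \<and> \<beta> = 0 \<or> (\<forall>t\<in>I. b t = 3 * a t \<and> c t = 0)))"
    (is "?L \<longleftrightarrow> ?R")
proof
  assume ?R
  then obtain \<alpha> \<beta> \<gamma> \<delta>
    where "\<And>x t u. t \<in> I \<Longrightarrow> \<phi> x t u = \<alpha> * x\<^sup>2 + \<beta> * x + \<gamma> * u + \<delta>"
      "\<gamma> = 0 \<or> (\<forall>t\<in>I. b t = 2 * a t)"
      "\<alpha> = 0 \<and> \<beta> = 0 \<or> (\<forall>t\<in>I. b t = 3 * a t \<and> c t = 0)"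
    by blast
  from quadratic_affine_is_substitution[OF I(1) this] show ?L by simp
next
  assume ?L
  then have sm: "smooth_xtu I \<phi>" and adj: "adjoint_identity I (evolution5 a b c d) \<phi>"
    by auto
  show ?R
  proof (rule determining_equations[OF sm adj d])
    fix A :: "real \<Rightarrow> real" and B :: "nat \<Rightarrow> real \<Rightarrow> real \<Rightarrow> real"
    assume aff: "\<And>x t u. t \<in> I \<Longrightarrow> \<phi> x t u = A t * u + B 0 x t"
      and DB: "\<And>k x t. ((\<lambda>x. B k x t) has_real_derivative B (Suc k) x t) (at x)"
      and Dt: "\<And>x t u y z. t \<in> I \<Longrightarrow> ((\<lambda>t. \<phi> x t u) has_real_derivative
        3 * A t * (b t - 2 * a t) * y * z + ((b t - 3 * a t) * z - c t * u\<^sup>2) * B 1 x t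
        + (b t - 3 * a t) * y * B 2 x t - a t * u * B 3 x t - d t * B 5 x t) (at t)"
    \<comment> \<open>The same t-derivative is computed with u_xx = 0 and u_xx = 1.\<close>
    have bB1: "(b t - 3 * a t) * B 1 x t = 0" if "t \<in> I" for t x
      using DERIV_unique[OF Dt[OF that, of x 0 0 0] Dt[OF that, of x 0 0 1]] by simp
    have bB2: "(b t - 3 * a t) * B 2 x t = 0" if "t \<in> I" for t x
      using DERIV_unique[OF Dt[OF that, of x 0 0 0] Dt[OF that, of x 0 1 0]] by simp
    have A: "A t * (b t - 2 * a t) = 0" if "t \<in> I" for t
      using DERIV_unique[OF Dt[OF that, of 0 0 0 0] Dt[OF that, of 0 0 1 1]]
        bB1[OF that, of 0] bB2[OF that, of 0] by auto
    have Dt0: "((\<lambda>t. \<phi> x t u) has_real_derivative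
        - c t * u\<^sup>2 * B 1 x t - a t * u * B 3 x t - d t * B 5 x t) (at t)" if "t \<in> I" for x t u
      using Dt[OF that, of x u 0 0] by simp
    \<comment> \<open>\<open>\<phi>\<close> is affine in \<open>u\<close>, so the \<open>u\<^sup>2\<close> term of \<open>\<phi>\<^sub>t\<close> vanishes\<close>
    have cB1: "c t * B 1 x t = 0" if t: "t \<in> I" for t x
    proof -
      have "- c t * 1\<^sup>2 * B 1 x t - a t * 1 * B 3 x t - d t * B 5 x t
          + (- c t * (-1)\<^sup>2 * B 1 x t - a t * (-1) * B 3 x t - d t * B 5 x t)
          - 2 * (- c t * 0\<^sup>2 * B 1 x t - a t * 0 * B 3 x t - d t * B 5 x t) = 0"
        by (rule DERIV_zero_if_zero_on_open[OF I(1) t,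
              of "\<lambda>t. \<phi> x t 1 + \<phi> x t (-1) - 2 * \<phi> x t 0"])
          (simp add: aff, intro DERIV_add DERIV_diff DERIV_cmult Dt0 t)
      then show ?thesis by simp
    qed
    have Dt_zero: "((\<lambda>t. \<phi> x t u) has_real_derivative 0) (at t)" if t: "t \<in> I" for x t u
    proof (cases "b t \<noteq> 3 * a t \<or> c t \<noteq> 0")
      case True
      then have "B 1 x t = 0" for x using bB1[OF t, of x] cB1[OF t, of x] by auto
      then have "B k x t = 0" if "1 \<le> k" for k x
        using DERIV_tower_zero[of "\<lambda>k x. B k x t", OF DB _ that] by blast
      then show ?thesis using Dt0[OF t, of x u] by simp
    next
      case False
      \<comment> \<open>Only the second alternative of \<open>alt\<close> survives, so A vanishes on
        all of \<open>I\<close>, not just at t. Hence phi is free of u there and its t-derivatives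
        at u = 1 and u = 0 can be equated.\<close>
      then have ne: "\<forall>t\<in>I. b t \<noteq> 2 * a t" using alt t by blast
      then have A0: "A t = 0" if "t \<in> I" for t using A[OF that] that by auto
      have "- c t * 1\<^sup>2 * B 1 x t - a t * 1 * B 3 x t - d t * B 5 x t
          - (- c t * 0\<^sup>2 * B 1 x t - a t * 0 * B 3 x t - d t * B 5 x t) = 0" for x
        by (rule DERIV_zero_if_zero_on_open[OF I(1) t, of "\<lambda>t. \<phi> x t 1 - \<phi> x t 0"])
          (simp add: aff A0, intro DERIV_diff Dt0 t)
      moreover have "a t \<noteq> 0" using ne t False by auto
      ultimately have "B 3 x t = 0" for x using False by simp
      then have "B k x t = 0" if "3 \<le> k" for k x
        using DERIV_tower_zero[of "\<lambda>k x. B k x t", OF DB _ that] by blast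
      then show ?thesis using Dt0[OF t, of x u] False by simp
    qed
    obtain t0 where t0: "t0 \<in> I" using I(3) by blast
    have const: "\<phi> x t u = \<phi> x t0 u" if "t \<in> I" for x t u
    proof -
      have "\<exists>k. \<forall>t\<in>I. \<phi> x t u = k"
        using I(2) Dt_zero
        by (intro has_field_derivative_zero_constant)
          (auto simp: is_interval_convex intro: has_field_derivative_at_within)
      then show ?thesis using that t0 by metis
    qed
    \<comment> \<open>The polynomial has its coefficients at \<open>t0\<close>, while the conditions
      on b and c may fail at another time; this carries B_x from one to the other.\<close>
    have B1: "B 1 x t = B 1 x t0" if "t \<in> I" for x t
    proof -
      have "(\<lambda>x. B 0 x t) = (\<lambda>x. B 0 x t0)"
        using const[OF that, of _ 0] aff[OF that, of _ 0] aff[OF t0, of _ 0] by simp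
      then show ?thesis using DERIV_unique[OF DB[of 0 t x]] DB[of 0 t0 x] by simp
    qed
    have A': "A t = A t0" if "t \<in> I" for t
      using const[OF that, of 0 1] const[OF that, of 0 0] aff[OF that, of 0] aff[OF t0, of 0] by simp
    have B3: "B 3 x t0 = 0" for x
    proof (cases "b t0 \<noteq> 3 * a t0 \<or> c t0 \<noteq> 0")
      case True
      then have "B 1 x t0 = 0" for x using bB1[OF t0, of x] cB1[OF t0, of x] by auto
      then show ?thesis
        using DERIV_tower_zero[of "\<lambda>k x. B k x t0", OF DB, of 1 3 x] by simp
    next
      case False
      then have "a t0 \<noteq> 0" using alt t0 by auto
      moreover have "- c t0 * u\<^sup>2 * B 1 x t0 - a t0 * u * B 3 x t0 - d t0 * B 5 x t0 = 0" for u
        using DERIV_unique[OF Dt0[OF t0] Dt_zero[OF t0]] .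
      from this[of 1] this[of 0] have "a t0 * B 3 x t0 = 0" using False by auto
      ultimately show ?thesis by simp
    qed
    note quad = quadratic_if_third_derivative_zero[of "\<lambda>k x. B k x t0", OF DB B3]
    show ?R
    proof (intro exI conjI allI ballI)
      fix x t u assume t: "t \<in> I"
      show "\<phi> x t u = B 2 0 t0 / 2 * x\<^sup>2 + B 1 0 t0 * x + A t0 * u + B 0 0 t0"
        using const[OF t] aff[OF t0] quad[of x] by simp
    next
      show "A t0 = 0 \<or> (\<forall>t\<in>I. b t = 2 * a t)" using A A' by auto
      show "B 2 0 t0 / 2 = 0 \<and> B 1 0 t0 = 0 \<or> (\<forall>t\<in>I. b t = 3 * a t \<and> c t = 0)"
      proof (rule disjCI)
        assume "\<not> (\<forall>t\<in>I. b t = 3 * a t \<and> c t = 0)"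
        then obtain t where t: "t \<in> I" "b t \<noteq> 3 * a t \<or> c t \<noteq> 0" by blast
        then have "B 1 x t0 = 0" for x
          using bB1[OF t(1), of x] cB1[OF t(1), of x] B1[OF t(1), of x] by auto
        then show "B 2 0 t0 / 2 = 0 \<and> B 1 0 t0 = 0"
          using DERIV_tower_zero[of "\<lambda>k x. B k x t0", OF DB, of 1 2 0] by simp
      qed
    qed
  qed
qed

text \<open>\<open>\<Phi>\<close> is described by membership so that each type reduces to
  simplifying two side conditions. The constant 1 witnesses nonlinear self-adjointness in every
  case.\<close>

lemma self_adjoint_exactlyI:
  assumes I: "open I" "is_interval I" "I \<noteq> {}" and d: "\<forall>t\<in>I. d t \<noteq> 0"
    and alt: "(\<forall>t\<in>I. b t \<noteq> 3 * a t \<or> c t \<noteq> 0) \<or> (\<forall>t\<in>I. b t \<noteq> 2 * a t)"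
    and \<Phi>: "\<And>\<psi>. \<psi> \<in> \<Phi> \<longleftrightarrow> (\<exists>\<alpha> \<beta> \<gamma> \<delta>. \<psi> = (\<lambda>x t u. \<alpha> * x\<^sup>2 + \<beta> * x + \<gamma> * u + \<delta>)
      \<and> (\<gamma> = 0 \<or> (\<forall>t\<in>I. b t = 2 * a t))
      \<and> (\<alpha> = 0 \<and> \<beta> = 0 \<or> (\<forall>t\<in>I. b t = 3 * a t \<and> c t = 0)))"
  shows "self_adjoint_exactly I (evolution5 a b c d) \<Phi>"
proof -
  have iff: "smooth_xtu I \<phi> \<and> adjoint_identity I (evolution5 a b c d) \<phi> \<longleftrightarrow>
      (\<exists>\<psi>\<in>\<Phi>. \<forall>x. \<forall>t\<in>I. \<forall>u. \<phi> x t u = \<psi> x t u)" for \<phi>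
    unfolding substitution_iff[OF I d alt] Bex_def \<Phi> by blast
  have "(\<lambda>x t u. 1) \<in> \<Phi>"
    unfolding \<Phi> by (intro exI[of _ 0] exI[of _ 1]) auto
  then have "smooth_xtu I (\<lambda>x t u. 1) \<and> adjoint_identity I (evolution5 a b c d) (\<lambda>x t u. 1)"
    unfolding iff by (intro bexI[of _ "\<lambda>x t u. 1"]) auto
  moreover have "nonzero_xtu I (\<lambda>x t u. 1)" using I(3) by (auto simp: nonzero_xtu_def)
  ultimately have "nonlinearly_self_adjoint I (evolution5 a b c d)"
    unfolding nonlinearly_self_adjoint_def by blast
  then show ?thesis unfolding self_adjoint_exactly_def using iff by blast
qed

theorem mainTheorem2:
  fixes I :: "real set" and a b c d :: "real \<Rightarrow> real"
  assumes "open I" and "is_interval I" and "I \<noteq> {}"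
    and "smooth_coeff I a" and "smooth_coeff I b" and "smooth_coeff I c" and "smooth_coeff I d"
    and "\<forall>t\<in>I. d t \<noteq> 0"
  shows
    "((\<forall>t\<in>I. b t \<noteq> 2 * a t \<and> b t \<noteq> 3 * a t) \<longrightarrow>
        self_adjoint_exactly I (evolution5 a b c d) {\<lambda>x t u. c1 | c1. True})
   \<and> ((\<forall>t\<in>I. b t = 3 * a t \<and> a t \<noteq> 0 \<and> c t \<noteq> 0) \<longrightarrow>
        self_adjoint_exactly I (evolution5 a b c d) {\<lambda>x t u. c1 | c1. True})
   \<and> ((\<forall>t\<in>I. b t = 3 * a t \<and> a t \<noteq> 0 \<and> c t = 0) \<longrightarrow>
        self_adjoint_exactly I (evolution5 a b c d)
          {\<lambda>x t u. c1 * x\<^sup>2 + c2 * x + c3 | c1 c2 c3. True})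
   \<and> ((\<forall>t\<in>I. b t = 2 * a t \<and> a t \<noteq> 0) \<longrightarrow>
        self_adjoint_exactly I (evolution5 a b c d) {\<lambda>x t u. c1 * u + c2 | c1 c2. True})
   \<and> ((\<forall>t\<in>I. a t = 0 \<and> b t = 0 \<and> c t \<noteq> 0) \<longrightarrow>
        self_adjoint_exactly I (evolution5 a b c d) {\<lambda>x t u. c1 * u + c2 | c1 c2. True})"
proof -
  have I: "open I" "is_interval I" "I \<noteq> {}" "\<forall>t\<in>I. d t \<noteq> 0" by fact+
  \<comment> \<open>A point of \<open>I\<close> refutes universal equations such as b = 2a, so the
    side conditions on the family become \<open>True\<close> or \<open>False\<close>.\<close>
  obtain t0 where t0: "t0 \<in> I" using I(3) by blast
  note exactlyI = self_adjoint_exactlyI[OF I]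
  show ?thesis
  proof (intro conjI impI)
    assume *: "\<forall>t\<in>I. b t \<noteq> 2 * a t \<and> b t \<noteq> 3 * a t"
    with t0 have cond: "(\<forall>t\<in>I. b t = 2 * a t) = False" "(\<forall>t\<in>I. b t = 3 * a t \<and> c t = 0) = False"
      by auto
    show "self_adjoint_exactly I (evolution5 a b c d) {\<lambda>x t u. c1 | c1. True}"
      by (rule exactlyI) (use * in force, unfold cond, simp)
  next
    assume *: "\<forall>t\<in>I. b t = 3 * a t \<and> a t \<noteq> 0 \<and> c t \<noteq> 0"
    with t0 have cond: "(\<forall>t\<in>I. b t = 2 * a t) = False" "(\<forall>t\<in>I. b t = 3 * a t \<and> c t = 0) = False"
      by auto
    show "self_adjoint_exactly I (evolution5 a b c d) {\<lambda>x t u. c1 | c1. True}"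
      by (rule exactlyI) (use * in force, unfold cond, simp)
  next
    assume *: "\<forall>t\<in>I. b t = 3 * a t \<and> a t \<noteq> 0 \<and> c t = 0"
    with t0 have cond: "(\<forall>t\<in>I. b t = 2 * a t) = False" "(\<forall>t\<in>I. b t = 3 * a t \<and> c t = 0) = True"
      by auto
    show "self_adjoint_exactly I (evolution5 a b c d) {\<lambda>x t u. c1 * x\<^sup>2 + c2 * x + c3 | c1 c2 c3. True}"
      by (rule exactlyI) (use * in force, unfold cond, simp)
  next
    assume *: "\<forall>t\<in>I. b t = 2 * a t \<and> a t \<noteq> 0"
    with t0 have cond: "(\<forall>t\<in>I. b t = 2 * a t) = True" "(\<forall>t\<in>I. b t = 3 * a t \<and> c t = 0) = False"
      by auto
    show "self_adjoint_exactly I (evolution5 a b c d) {\<lambda>x t u. c1 * u + c2 | c1 c2. True}"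
      by (rule exactlyI) (use * in force, unfold cond, simp)
  next
    \<comment> \<open>Here b = 2a and b = 3a hold together; c \<noteq> 0 alone excludes dependence
      on x.\<close>
    assume *: "\<forall>t\<in>I. a t = 0 \<and> b t = 0 \<and> c t \<noteq> 0"
    with t0 have cond: "(\<forall>t\<in>I. b t = 2 * a t) = True" "(\<forall>t\<in>I. b t = 3 * a t \<and> c t = 0) = False"
      by auto
    show "self_adjoint_exactly I (evolution5 a b c d) {\<lambda>x t u. c1 * u + c2 | c1 c2. True}"
      by (rule exactlyI) (use * in force, unfold cond, simp)
  qed
qed

end
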